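(* Let $X$ be a real Banach space. Then $X$ is finite dimensional if and only if limited differentiability and Fréchet differentiability coincide for real-valued Lipschitz functions on $X$; that is, if and only if for every Lipschitz function $f:X\to\mathbb{R}$ and every $x\in X$, $f$ is limited differentiable at $x$ exactly when $f$ is Fréchet differentiable at $x$.
   Context: A bounded set $A\subset X$ is limited if for every weak$^*$-null sequence $(x_n^* )_n\subset X^*$ one has $\lim_{n}\sup_{x\in A}|\langle x_n^*,x\rangle|=0$. For a family $\beta$ of bounded nonempty subsets of $X$, a function $f:X\to\mathbb{R}$ is $\beta$-differentiable at $x_0\in X$ if there is a bounded linear functional $d_\beta f(x_0):X\to\mathbb{R}$ such that $\lim_{t\to 0}\sup_{u\in A}\left|\frac{f(x_0+tu)-f(x_0)}{t}-d_\beta f(x_0)(u)\right|=0$ for every $A\in\beta$. Limited and Fréchet differentiability are $\beta$-differentiability for $\beta$ the family of all nonempty limited sets and of all nonempty bounded sets, respectively. *)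

theory Defs
  imports "HOL-Analysis.Analysis"
begin

definition weak_star_null :: "(nat \<Rightarrow> ('a::real_normed_vector \<Rightarrow>\<^sub>L real)) \<Rightarrow> bool" where
  "weak_star_null \<phi> \<longleftrightarrow> (\<forall>x. (\<lambda>n. blinfun_apply (\<phi> n) x) \<longlonglongrightarrow> 0)"

text \<open>Suprema of absolute values are taken in \<^typ>\<open>ennreal\<close>: there the supremum of an unbounded
  set is infinite and that of the empty set is 0, while in \<^typ>\<open>real\<close> both are junk values.\<close>

definition limited_set :: "'a::real_normed_vector set \<Rightarrow> bool" where
  "limited_set A \<longleftrightarrow> bounded A \<and>
     (\<forall>\<phi>. weak_star_null \<phi> \<longrightarrow>
        (\<lambda>n. SUP x\<in>A. ennreal \<bar>blinfun_apply (\<phi> n) x\<bar>) \<longlonglongrightarrow> 0)"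

definition beta_differentiable ::
    "'a::real_normed_vector set set \<Rightarrow> ('a \<Rightarrow> real) \<Rightarrow> 'a \<Rightarrow> bool" where
  "beta_differentiable \<beta> f x \<longleftrightarrow>
     (\<exists>D :: 'a \<Rightarrow>\<^sub>L real. \<forall>A\<in>\<beta>.
        ((\<lambda>t::real. SUP u\<in>A. ennreal \<bar>(f (x + t *\<^sub>R u) - f x) / t - blinfun_apply D u\<bar>)
           \<longlongrightarrow> 0) (at 0))"

definition limited_differentiable :: "('a::real_normed_vector \<Rightarrow> real) \<Rightarrow> 'a \<Rightarrow> bool" where
  "limited_differentiable = beta_differentiable {A. A \<noteq> {} \<and> limited_set A}"

definition frechet_differentiable :: "('a::real_normed_vector \<Rightarrow> real) \<Rightarrow> 'a \<Rightarrow> bool" where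
  "frechet_differentiable = beta_differentiable {A. A \<noteq> {} \<and> bounded A}"

lemma tendsto_SUP_ennreal_iff_uniform_limit:
  fixes g :: "'t \<Rightarrow> 'a \<Rightarrow> real"
  shows "((\<lambda>t. SUP u\<in>A. ennreal \<bar>g t u - h u\<bar>) \<longlongrightarrow> 0) F \<longleftrightarrow> uniform_limit A g h F"
proof
  assume *: "((\<lambda>t. SUP u\<in>A. ennreal \<bar>g t u - h u\<bar>) \<longlongrightarrow> 0) F"
  show "uniform_limit A g h F"
  proof (rule uniform_limitI)
    fix e :: real assume "e > 0"
    then have "\<forall>\<^sub>F t in F. (SUP u\<in>A. ennreal \<bar>g t u - h u\<bar>) < ennreal e"
      using order_tendstoD(2)[OF *, of "ennreal e"] by simp
    then show "\<forall>\<^sub>F t in F. \<forall>u\<in>A. dist (g t u) (h u) < e"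
    proof (rule eventually_mono)
      fix t assume s: "(SUP u\<in>A. ennreal \<bar>g t u - h u\<bar>) < ennreal e"
      show "\<forall>u\<in>A. dist (g t u) (h u) < e"
      proof
        fix u assume "u \<in> A"
        then have "ennreal \<bar>g t u - h u\<bar> < ennreal e"
          using s by (meson SUP_upper le_less_trans)
        then show "dist (g t u) (h u) < e"
          by (simp add: dist_real_def ennreal_less_iff)
      qed
    qed
  qed
next
  assume *: "uniform_limit A g h F"
  show "((\<lambda>t. SUP u\<in>A. ennreal \<bar>g t u - h u\<bar>) \<longlongrightarrow> 0) F"
  proof (rule order_tendstoI)
    fix a :: ennreal assume "0 < a"
    then obtain b where b: "0 < b" "b < a" using dense by blast
    then obtain e where e: "b = ennreal e" "e > 0"
      by (cases b) auto
    have "\<forall>\<^sub>F t in F. \<forall>u\<in>A. dist (g t u) (h u) < e"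
      using * e by (simp add: uniform_limit_iff)
    then show "\<forall>\<^sub>F t in F. (SUP u\<in>A. ennreal \<bar>g t u - h u\<bar>) < a"
    proof (rule eventually_mono)
      fix t assume "\<forall>u\<in>A. dist (g t u) (h u) < e"
      then have "(SUP u\<in>A. ennreal \<bar>g t u - h u\<bar>) \<le> b"
        unfolding e by (intro SUP_least ennreal_leI) (auto simp: dist_real_def less_imp_le)
      then show "(SUP u\<in>A. ennreal \<bar>g t u - h u\<bar>) < a" using b by simp
    qed
  qed simp
qed

lemma frechet_differentiable_iff:
  fixes f :: "'a::real_normed_vector \<Rightarrow> real"
  shows "frechet_differentiable f x \<longleftrightarrow> f differentiable (at x)"
proof
  assume "frechet_differentiable f x"
  then obtain D :: "'a \<Rightarrow>\<^sub>L real" where D: "\<And>A. A \<noteq> {} \<Longrightarrow> bounded A \<Longrightarrow>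
      uniform_limit A (\<lambda>t u. (f (x + t *\<^sub>R u) - f x) / t) (blinfun_apply D) (at 0)"
    unfolding frechet_differentiable_def beta_differentiable_def
      tendsto_SUP_ennreal_iff_uniform_limit by auto
  have "(f has_derivative blinfun_apply D) (at x)"
    unfolding has_derivative_at_alt
  proof (intro conjI allI impI)
    show "bounded_linear (blinfun_apply D)" by (rule blinfun.bounded_linear_right)
    fix e :: real assume e: "e > 0"
    have "uniform_limit (cball 0 1) (\<lambda>t u. (f (x + t *\<^sub>R u) - f x) / t) (blinfun_apply D) (at 0)"
      by (rule D) auto
    then obtain d where d: "d > 0"
      "\<And>t u. t \<noteq> 0 \<Longrightarrow> \<bar>t\<bar> < d \<Longrightarrow> norm u \<le> 1 \<Longrightarrow> \<bar>(f (x + t *\<^sub>R u) - f x) / t - D u\<bar> < e"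
      using e unfolding uniform_limit_iff eventually_at by (auto simp: dist_real_def)
    have "norm (f y - f x - D (y - x)) \<le> e * norm (y - x)" if y: "norm (y - x) < d" for y
    proof (cases "y = x")
      case False
      define t where "t = norm (y - x)"
      define u where "u = (y - x) /\<^sub>R t"
      have t: "t > 0" "t < d" using False y by (auto simp: t_def)
      have u: "norm u \<le> 1" "t *\<^sub>R u = y - x" using t by (auto simp: u_def t_def)
      have yx: "y = x + t *\<^sub>R u" using u by simp
      have "\<bar>(f y - f x) / t - D u\<bar> < e" using d(2)[of t u] t u(1) by (simp add: yx[symmetric])
      moreover have "f y - f x - D (y - x) = t * ((f y - f x) / t - D u)"
        using t by (simp add: u(2)[symmetric] blinfun.scaleR_right field_simps)
      ultimately show ?thesis
        using t by (simp add: abs_mult t_def[symmetric] mult.commute)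
    qed (simp add: blinfun.zero_right)
    then show "\<exists>d>0. \<forall>y. norm (y - x) < d \<longrightarrow> norm (f y - f x - D (y - x)) \<le> e * norm (y - x)"
      using d(1) by blast
  qed
  then show "f differentiable (at x)" by (auto simp: differentiable_def)
next
  assume "f differentiable (at x)"
  then obtain f' where f': "(f has_derivative f') (at x)" by (auto simp: differentiable_def)
  define D where "D = Blinfun f'"
  have D: "blinfun_apply D = f'"
    unfolding D_def using f' has_derivative_bounded_linear by (blast intro: bounded_linear_Blinfun_apply)
  have "uniform_limit A (\<lambda>t u. (f (x + t *\<^sub>R u) - f x) / t) (blinfun_apply D) (at 0)"
    if A: "bounded A" for A
  proof (rule uniform_limitI)
    fix e :: real assume e: "e > 0"
    obtain M where M: "M > 0" "\<And>u. u \<in> A \<Longrightarrow> norm u \<le> M"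
      using A by (auto simp: bounded_pos)
    define c where "c = e / (2 * M)"
    have c: "c > 0" "c * M < e" using e M by (auto simp: c_def field_simps)
    obtain d where d: "d > 0"
      "\<And>y. norm (y - x) < d \<Longrightarrow> norm (f y - f x - D (y - x)) \<le> c * norm (y - x)"
      using f' c unfolding has_derivative_at_alt D[symmetric] by blast
    have "dist ((f (x + t *\<^sub>R u) - f x) / t) (D u) < e"
      if t: "t \<noteq> 0" "\<bar>t\<bar> < d / M" and u: "u \<in> A" for t u
    proof -
      have "\<bar>t\<bar> * norm u \<le> \<bar>t\<bar> * M" using M(2)[OF u] by (simp add: mult_left_mono)
      also have "\<dots> < d" using t M by (simp add: field_simps)
      finally have "\<bar>f (x + t *\<^sub>R u) - f x - D (t *\<^sub>R u)\<bar> \<le> c * (\<bar>t\<bar> * norm u)"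
        using d(2)[of "x + t *\<^sub>R u"] by simp
      moreover have "f (x + t *\<^sub>R u) - f x - D (t *\<^sub>R u) = t * ((f (x + t *\<^sub>R u) - f x) / t - D u)"
        using t(1) by (simp add: blinfun.scaleR_right field_simps)
      ultimately have "\<bar>t\<bar> * \<bar>(f (x + t *\<^sub>R u) - f x) / t - D u\<bar> \<le> \<bar>t\<bar> * (c * norm u)"
        by (simp add: abs_mult mult.left_commute)
      then have "\<bar>(f (x + t *\<^sub>R u) - f x) / t - D u\<bar> \<le> c * norm u" using t by simp
      also have "\<dots> \<le> c * M" using M(2)[OF u] c by simp
      also have "\<dots> < e" by (rule c)
      finally show ?thesis by (simp add: dist_real_def)
    qed
    moreover have "d / M > 0" using d M by simp
    ultimately show "\<forall>\<^sub>F t in at 0. \<forall>u\<in>A. dist ((f (x + t *\<^sub>R u) - f x) / t) (D u) < e"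
      unfolding eventually_at by (intro exI[of _ "d / M"]) (auto simp: dist_real_def)
  qed
  then show "frechet_differentiable f x"
    unfolding frechet_differentiable_def beta_differentiable_def
      tendsto_SUP_ennreal_iff_uniform_limit by auto
qed

end

(* In infinite dimension the Josefson-Nissenzweig theorem gives functionals phi n of norm one that
   tend to 0 weak*.  The function f x = sup_n max 0 (|phi n x| - 1/(n+1)) is then 1-Lipschitz and
   limited differentiable at 0, because phi n tends to 0 uniformly on limited sets, but it is not
   Frechet differentiable at 0, because sup f over the ball of radius 2/(n+1) is at least a quarter
   of that radius.

   Josefson-Nissenzweig: suppose that every weak* null sequence is norm null.  If all convex blocks
   of some sequence in the dual ball oscillated by a fixed amount at points of the unit ball, one
   could build functionals phi j and unit vectors y j with sum_j (phi j z)^2 <= |z|^2 and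
   phi j (y j) >= delta; then phi would be weak* null but not norm null.  So by diagonalisation every
   sequence in the dual ball has pointwise convergent convex blocks, and these converge in norm since
   their differences are weak* null.  Take a normalised sequence f in the dual in which each
   term vanishes on finite sets that norm the span of the earlier ones.  It is not weak* null, so
   f n x >= e along a subsequence, for some x and e > 0; the norm limit G of convex blocks of
   this subsequence satisfies G x >= e, but vanishes on all the norming sets, hence is 0. *)

theory Submission
  imports Defs
begin

section \<open>Finite-dimensional subspaces\<close>

text \<open>A convergent sequence is bounded, so it stays in one compact slice, and so does its
  limit. The induction of the next lemma carries compactness of all slices and recovers closedness
  of the span from it.\<close>

lemma closed_if_compact_Int_cball:
  fixes S :: "'a::real_normed_vector set"
  assumes "\<And>r. compact (S \<inter> cball 0 r)"
  shows "closed S"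
  unfolding closed_sequential_limits
proof (intro allI impI, elim conjE)
  fix s l assume s: "\<forall>n. s n \<in> S" "s \<longlonglongrightarrow> l"
  obtain r where r: "\<And>n. norm (s n) \<le> r"
    using convergent_imp_bounded[OF s(2)] by (auto simp: bounded_iff)
  have "closed (S \<inter> cball 0 r)" using assms by (rule compact_imp_closed)
  then have "l \<in> S \<inter> cball 0 r" by (rule closed_sequentially[OF _ _ s(2)]) (use s r in simp)
  then show "l \<in> S" by simp
qed

text \<open>Induction on \<open>B\<close>. A new vector \<open>b\<close> outside the closed subspace
  \<open>span B\<close> has positive distance \<open>d\<close> from it, which bounds its coefficient
  in a vector of norm at most \<open>r\<close> by \<open>r / d\<close>. The ball is therefore a
  closed part of a continuous image of a compact product. The radius must vary, since the component
  in \<open>span B\<close> lies in a larger ball.\<close>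

lemma compact_span_Int_cball:
  fixes B :: "'a::real_normed_vector set"
  assumes "finite B"
  shows "compact (span B \<inter> cball 0 r)"
  using assms
proof (induction B arbitrary: r rule: finite_induct)
  case empty
  then show ?case by (simp add: finite_imp_compact)
next
  case (insert b B)
  have cl: "closed (span B)" by (rule closed_if_compact_Int_cball) (rule insert.IH)
  show ?case
  proof (cases "b \<in> span B")
    case True
    then show ?thesis using insert.IH[of r] by (simp add: span_redundant)
  next
    case False
    define d where "d = infdist b (span B)"
    have d: "d > 0"
      unfolding d_def using False cl span_zero[of B] by (intro infdist_pos_not_in_closed) auto
    have coeff: "\<bar>c\<bar> * d \<le> norm (y + c *\<^sub>R b)" if y: "y \<in> span B" for y c
    proof (cases "c = 0")
      case False
      have "d \<le> dist b ((-1/c) *\<^sub>R y)" unfolding d_def using y by (intro infdist_le span_scale)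
      then have "\<bar>c\<bar> * d \<le> \<bar>c\<bar> * norm (b - (-1/c) *\<^sub>R y)" by (simp add: dist_norm mult_left_mono)
      also have "\<dots> = norm (c *\<^sub>R (b - (-1/c) *\<^sub>R y))" by simp
      also have "c *\<^sub>R (b - (-1/c) *\<^sub>R y) = y + c *\<^sub>R b" using False by (simp add: algebra_simps)
      finally show ?thesis .
    qed simp
    define R where "R = r / d"
    \<comment> \<open>\<open>R\<close> bounds the coefficient of \<open>b\<close>, and
      \<open>r + R * norm b\<close> bounds the norm of what remains after subtracting that multiple.
      \<open>K\<close> may exceed the ball of radius \<open>r\<close>, hence the intersection
      below.\<close>
    define K where "K = (\<lambda>(y, c). y + c *\<^sub>R b) ` ((span B \<inter> cball 0 (r + R * norm b)) \<times> {-R..R})"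
    have "compact K"
      unfolding K_def case_prod_unfold
      by (intro compact_continuous_image compact_Times insert.IH compact_Icc continuous_intros)
    moreover have "span (insert b B) \<inter> cball 0 r = K \<inter> cball 0 r"
    proof (intro equalityI subsetI)
      fix x assume x: "x \<in> span (insert b B) \<inter> cball 0 r"
      then obtain c where c: "x - c *\<^sub>R b \<in> span B" by (auto simp: span_insert)
      have "\<bar>c\<bar> * d \<le> r" using coeff[OF c, of c] x by simp
      then have cR: "\<bar>c\<bar> \<le> R" using d by (simp add: R_def field_simps)
      have "norm (x - c *\<^sub>R b) \<le> norm x + \<bar>c\<bar> * norm b" using norm_triangle_ineq4[of x "c *\<^sub>R b"] by simp
      also have "\<dots> \<le> r + R * norm b" using x cR by (intro add_mono mult_right_mono) auto
      finally have "(x - c *\<^sub>R b, c) \<in> (span B \<inter> cball 0 (r + R * norm b)) \<times> {-R..R}"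
        using c cR by auto
      then have "(\<lambda>(y, c). y + c *\<^sub>R b) (x - c *\<^sub>R b, c) \<in> K" unfolding K_def by (rule imageI)
      then show "x \<in> K \<inter> cball 0 r" using x by simp
    next
      fix x assume "x \<in> K \<inter> cball 0 r"
      then obtain y c where "x = y + c *\<^sub>R b" "y \<in> span B" "x \<in> cball 0 r" by (auto simp: K_def)
      then show "x \<in> span (insert b B) \<inter> cball 0 r" by (auto simp: span_insert intro: exI[of _ c])
    qed
    ultimately show ?thesis by (simp add: compact_Int_closed)
  qed
qed

lemma closed_span_finite:
  fixes B :: "'a::real_normed_vector set"
  shows "finite B \<Longrightarrow> closed (span B)"
  by (intro closed_if_compact_Int_cball compact_span_Int_cball)

section \<open>The Hahn--Banach theorem\<close>

text \<open>Homogeneity is demanded only as an inequality for positive scalars, which is easy to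
  check for infima; applying it to \<open>c\<close> and to \<open>1/c\<close> gives
  equality.\<close>

definition sublinear :: "('a::real_vector \<Rightarrow> real) \<Rightarrow> bool" where
  "sublinear p \<longleftrightarrow> (\<forall>x y. p (x + y) \<le> p x + p y) \<and> (\<forall>c>0. \<forall>x. p (c *\<^sub>R x) \<le> c * p x)"

lemma sublinear_add: "sublinear p \<Longrightarrow> p (x + y) \<le> p x + p y"
  by (simp add: sublinear_def)

lemma sublinear_zero: "sublinear p \<Longrightarrow> p 0 = 0"
proof -
  assume p: "sublinear p"
  \<comment> \<open>The first inequality forces \<open>p 0\<close> to be nonnegative, the second
    nonpositive.\<close>
  have "p (2 *\<^sub>R 0) \<le> 2 * p 0" "p ((1/2) *\<^sub>R 0) \<le> (1/2) * p 0"
    using p unfolding sublinear_def by (meson zero_less_numeral half_gt_zero zero_less_one)+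
  then show ?thesis by simp
qed

lemma sublinear_scaleR: "sublinear p \<Longrightarrow> c \<ge> 0 \<Longrightarrow> p (c *\<^sub>R x) = c * p x"
proof (cases "c = 0")
  case False
  assume p: "sublinear p" and "c \<ge> 0"
  then have c: "c > 0" using False by simp
  have "p ((1/c) *\<^sub>R (c *\<^sub>R x)) \<le> (1/c) * p (c *\<^sub>R x)"
    using p c unfolding sublinear_def by (meson divide_pos_pos zero_less_one)
  then have "c * p x \<le> p (c *\<^sub>R x)" using c by (simp add: field_simps)
  moreover have "p (c *\<^sub>R x) \<le> c * p x" using p c unfolding sublinear_def by blast
  ultimately show ?thesis by simp
qed (simp add: sublinear_zero)

lemma sublinear_ge: "sublinear p \<Longrightarrow> - p (- x) \<le> p x"
  using sublinear_add[of p x "- x"] sublinear_zero[of p] by simp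

text \<open>Take the infimum over \<open>t \<ge> 0\<close> of
  \<open>p (x + t *\<^sub>R y) - t * p y\<close>: \<open>t = 0\<close> gives
  \<open>q \<le> p\<close> and \<open>t = 1\<close> the last bound. At \<open>x = - y\<close> that
  bound forces the value down to \<open>- p y\<close>, which is how linearity and prescribed values
  arise later.\<close>

lemma sublinear_decrease:
  fixes p :: "'a::real_vector \<Rightarrow> real"
  assumes p: "sublinear p"
  obtains q where "sublinear q" "q \<le> p" "\<And>x. q x \<le> p (x + y) - p y"
proof -
  define S where "S = (\<lambda>x. (\<lambda>t. p (x + t *\<^sub>R y) - t * p y) ` {0::real..})"
  define q where "q = (\<lambda>x. Inf (S x))"
  have bdd: "bdd_below (S x)" for x
  proof (rule bdd_belowI)
    fix s assume "s \<in> S x"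
    then obtain t where t: "t \<ge> 0" "s = p (x + t *\<^sub>R y) - t * p y" by (auto simp: S_def)
    show "- p (- x) \<le> s"
      using sublinear_add[OF p, of "x + t *\<^sub>R y" "- x"] sublinear_scaleR[OF p t(1), of y] t by simp
  qed
  have le: "q x \<le> p (x + t *\<^sub>R y) - t * p y" if "t \<ge> 0" for x t
    unfolding q_def using that by (intro cInf_lower bdd) (auto simp: S_def)
  have ge: "a \<le> q x" if "\<And>t. t \<ge> 0 \<Longrightarrow> a \<le> p (x + t *\<^sub>R y) - t * p y" for a x
    unfolding q_def using that by (intro cInf_greatest) (auto simp: S_def)
  have "sublinear q" unfolding sublinear_def
  proof (intro conjI allI impI)
    fix x x'
    \<comment> \<open>Parameters \<open>t\<close> for \<open>x\<close> and \<open>t'\<close> for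
      \<open>x'\<close> are both served by \<open>t + t'\<close> for the sum, so the two infima can
      be taken one after the other.\<close>
    have "q (x + x') - (p (x' + t' *\<^sub>R y) - t' * p y) \<le> q x" if t': "t' \<ge> 0" for t'
    proof (rule ge)
      fix t :: real assume t: "t \<ge> 0"
      have "q (x + x') \<le> p (x + x' + (t + t') *\<^sub>R y) - (t + t') * p y" using t t' by (intro le) simp
      also have "\<dots> \<le> (p (x + t *\<^sub>R y) + p (x' + t' *\<^sub>R y)) - (t + t') * p y"
        using sublinear_add[OF p, of "x + t *\<^sub>R y" "x' + t' *\<^sub>R y"] by (simp add: algebra_simps)
      finally show "q (x + x') - (p (x' + t' *\<^sub>R y) - t' * p y) \<le> p (x + t *\<^sub>R y) - t * p y"
        by (simp add: algebra_simps)
    qed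
    then have "q (x + x') - q x \<le> q x'" by (intro ge) (simp add: algebra_simps)
    then show "q (x + x') \<le> q x + q x'" by simp
  next
    fix c :: real and x assume c: "c > 0"
    have "q (c *\<^sub>R x) / c \<le> q x"
    proof (rule ge)
      fix t :: real assume t: "t \<ge> 0"
      have "q (c *\<^sub>R x) \<le> p (c *\<^sub>R x + (c * t) *\<^sub>R y) - (c * t) * p y" using c t by (intro le) simp
      also have "c *\<^sub>R x + (c * t) *\<^sub>R y = c *\<^sub>R (x + t *\<^sub>R y)" by (simp add: algebra_simps)
      also have "p \<dots> = c * p (x + t *\<^sub>R y)" using c by (intro sublinear_scaleR p) simp
      finally show "q (c *\<^sub>R x) / c \<le> p (x + t *\<^sub>R y) - t * p y" using c by (simp add: field_simps)
    qed
    then show "q (c *\<^sub>R x) \<le> c * q x" using c by (simp add: field_simps)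
  qed
  moreover have "q \<le> p" using le[of 0] by (simp add: le_fun_def)
  moreover have "q x \<le> p (x + y) - p y" for x using le[of 1 x] by simp
  ultimately show ?thesis using that by blast
qed

text \<open>The pointwise infimum is finite because every member lies above
  \<open>- p (- x)\<close>. For subadditivity, two members used at \<open>x\<close> and at
  \<open>y\<close> are replaced by the smaller of them, which the chain condition provides.\<close>

lemma sublinear_Inf_chain:
  fixes p :: "'a::real_vector \<Rightarrow> real"
  assumes C: "C \<noteq> {}" "\<And>q. q \<in> C \<Longrightarrow> sublinear q \<and> q \<le> p"
    and chain: "\<And>q r. q \<in> C \<Longrightarrow> r \<in> C \<Longrightarrow> q \<le> r \<or> r \<le> q"
  obtains u where "sublinear u" "\<And>q. q \<in> C \<Longrightarrow> u \<le> q"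
proof -
  define u where "u = (\<lambda>x. INF q\<in>C. q x)"
  have bdd: "bdd_below ((\<lambda>q. q x) ` C)" for x
  proof (rule bdd_belowI2)
    fix q assume q: "q \<in> C"
    have "- p (- x) \<le> - q (- x)" using C(2)[OF q] by (simp add: le_fun_def)
    also have "\<dots> \<le> q x" using C(2)[OF q] by (simp add: sublinear_ge)
    finally show "- p (- x) \<le> q x" .
  qed
  have le: "u x \<le> q x" if "q \<in> C" for q x unfolding u_def using that by (intro cINF_lower bdd)
  have ge: "a \<le> u x" if "\<And>q. q \<in> C \<Longrightarrow> a \<le> q x" for a x
    unfolding u_def using that C by (intro cINF_greatest)
  have "sublinear u" unfolding sublinear_def
  proof (intro conjI allI impI)
    fix x y
    have "u (x + y) - q y \<le> r x" if q: "q \<in> C" and r: "r \<in> C" for q r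
    proof -
      have "\<exists>s\<in>C. s \<le> q \<and> s \<le> r" using chain[OF q r] q r by blast
      then obtain s where s: "s \<in> C" "s x \<le> r x" "s y \<le> q y" by (auto simp: le_fun_def)
      have "u (x + y) \<le> s x + s y" using le[OF s(1), of "x + y"] C(2)[OF s(1)] sublinear_add[of s x y] by simp
      then show ?thesis using s by simp
    qed
    then have "u (x + y) - q y \<le> u x" if "q \<in> C" for q using that by (intro ge)
    then have "u (x + y) - u x \<le> u y" by (intro ge) (simp add: algebra_simps)
    then show "u (x + y) \<le> u x + u y" by simp
  next
    fix c :: real and x assume c: "c > 0"
    have "u (c *\<^sub>R x) / c \<le> u x"
    proof (rule ge)
      fix q assume q: "q \<in> C"
      have "u (c *\<^sub>R x) \<le> c * q x"
        using le[OF q, of "c *\<^sub>R x"] C(2)[OF q] sublinear_scaleR[of q c x] c by simp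
      then show "u (c *\<^sub>R x) / c \<le> q x" using c by (simp add: field_simps)
    qed
    then show "u (c *\<^sub>R x) \<le> c * u x" using c by (simp add: field_simps)
  qed
  then show ?thesis using that le by (simp add: le_fun_def)
qed

text \<open>A pointwise minimal sublinear functional is linear, since \<open>sublinear_decrease\<close> cannot decrease it.\<close>

lemma exists_linear_le_sublinear:
  fixes p :: "'a::real_vector \<Rightarrow> real"
  assumes p: "sublinear p"
  obtains q where "linear q" "q \<le> p"
proof -
  define A where "A = {q. sublinear q \<and> q \<le> p}"
  \<comment> \<open>The order is reversed, so that Zorn's lemma delivers a minimal function.\<close>
  define P where "P = (\<lambda>q r :: 'a \<Rightarrow> real. r \<le> q)"
  have "\<exists>m\<in>A. \<forall>a\<in>A. P m a \<longrightarrow> a = m"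
  proof (rule predicate_Zorn)
    show "partial_order_on A (relation_of P A)"
      by (rule partial_order_on_relation_ofI) (auto simp: P_def)
    fix C assume C: "C \<in> Chains (relation_of P A)"
    then have CA: "\<And>q. q \<in> C \<Longrightarrow> sublinear q \<and> q \<le> p"
      and ch: "\<And>q r. q \<in> C \<Longrightarrow> r \<in> C \<Longrightarrow> q \<le> r \<or> r \<le> q"
      by (auto simp: Chains_def relation_of_def P_def A_def)
    show "\<exists>u\<in>A. \<forall>a\<in>C. P a u"
    proof (cases "C = {}")
      case False
      obtain u where u: "sublinear u" "\<And>q. q \<in> C \<Longrightarrow> u \<le> q"
        using sublinear_Inf_chain[OF False CA ch] by blast
      moreover have "u \<le> p" using False u CA by (meson ex_in_conv order_trans)
      ultimately show ?thesis by (auto simp: A_def P_def)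
    qed (use p in \<open>auto simp: A_def\<close>)
  qed
  then obtain q where q: "sublinear q" "q \<le> p" and min: "\<And>r. sublinear r \<Longrightarrow> r \<le> q \<Longrightarrow> r = q"
    by (auto simp: A_def P_def intro: order_trans)
  have add: "q (x + y) = q x + q y" for x y
  proof (rule antisym)
    \<comment> \<open>By minimality \<open>r\<close> equals \<open>q\<close>, so its third property
      becomes superadditivity of \<open>q\<close>.\<close>
    obtain r where r: "sublinear r" "r \<le> q" "\<And>x. r x \<le> q (x + y) - q y"
      using sublinear_decrease[OF q(1)] by blast
    show "q x + q y \<le> q (x + y)" using r(3)[of x] min[OF r(1,2)] by simp
  qed (rule sublinear_add[OF q(1)])
  have neg: "q (- x) = - q x" for x using add[of x "- x"] sublinear_zero[OF q(1)] by simp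
  have "q (c *\<^sub>R x) = c * q x" for c x
  proof (cases "c \<ge> 0")
    case False
    then show ?thesis using sublinear_scaleR[OF q(1), of "- c" x] neg[of "c *\<^sub>R x"] by simp
  qed (rule sublinear_scaleR[OF q(1)])
  then have "linear q" using add by (intro linearI) auto
  then show ?thesis using q that by blast
qed

text \<open>Decreasing \<open>p\<close> along \<open>x0\<close> first pushes the value at
  \<open>- x0\<close> down to \<open>- p x0\<close>; every linear functional below the result then
  has value at least \<open>p x0\<close> at \<open>x0\<close>.\<close>

theorem Hahn_Banach_sublinear:
  fixes p :: "'a::real_vector \<Rightarrow> real"
  assumes p: "sublinear p"
  obtains q where "linear q" "q \<le> p" "q x0 = p x0"
proof -
  obtain r where r: "sublinear r" "r \<le> p" "\<And>x. r x \<le> p (x + x0) - p x0"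
    using sublinear_decrease[OF p] by blast
  obtain q where q: "linear q" "q \<le> r" using exists_linear_le_sublinear[OF r(1)] by blast
  have "q (- x0) \<le> - p x0"
    using r(3)[of "- x0"] le_funD[OF q(2), of "- x0"] sublinear_zero[OF p] by simp
  then have "p x0 \<le> q x0" using linear_neg[OF q(1), of x0] by simp
  moreover have "q \<le> p" using q(2) r(2) by (rule order_trans)
  ultimately show ?thesis using that[OF q(1)] by (simp add: le_fun_def antisym)
qed

section \<open>Functionals vanishing on a finite set, via the distance to its span\<close>

lemma sublinear_infdist:
  fixes S :: "'a::real_normed_vector set"
  assumes S: "subspace S"
  shows "sublinear (\<lambda>x. infdist x S)"
  unfolding sublinear_def
proof (intro conjI allI impI)
  have ne: "S \<noteq> {}" using S subspace_0 by blast
  have ge: "a \<le> infdist x S" if "\<And>s. s \<in> S \<Longrightarrow> a \<le> dist x s" for a x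
    using that ne by (simp add: infdist_def cINF_greatest)
  fix x y
  have "infdist (x + y) S - dist y t \<le> dist x s" if "s \<in> S" "t \<in> S" for s t
  proof -
    have "infdist (x + y) S \<le> dist (x + y) (s + t)" using that S by (intro infdist_le subspace_add)
    also have "\<dots> \<le> dist x s + dist y t" by (rule dist_triangle_add)
    finally show ?thesis by simp
  qed
  then have "infdist (x + y) S - dist y t \<le> infdist x S" if "t \<in> S" for t using that by (intro ge)
  then have "infdist (x + y) S - infdist x S \<le> infdist y S" by (intro ge) (simp add: algebra_simps)
  then show "infdist (x + y) S \<le> infdist x S + infdist y S" by simp
next
  have ne: "S \<noteq> {}" using S subspace_0 by blast
  fix c :: real and x assume c: "c > 0"
  have "infdist (c *\<^sub>R x) S / c \<le> dist x s" if "s \<in> S" for s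
  proof -
    have "infdist (c *\<^sub>R x) S \<le> dist (c *\<^sub>R x) (c *\<^sub>R s)" using that S by (intro infdist_le subspace_scale)
    also have "\<dots> = c * dist x s"
      using c by (simp add: dist_norm flip: scaleR_diff_right)
    finally show ?thesis using c by (simp add: field_simps)
  qed
  then have "infdist (c *\<^sub>R x) S / c \<le> infdist x S" using ne by (simp add: infdist_def cINF_greatest)
  then show "infdist (c *\<^sub>R x) S \<le> c * infdist x S" using c by (simp add: field_simps)
qed

text \<open>The span of \<open>F\<close> is closed and proper, so some \<open>x0\<close> has
  positive distance from it. A linear functional below this distance is bounded by the norm and
  vanishes on the span; matching the distance at \<open>x0\<close> makes it nonzero, and it can be
  normalised.\<close>

lemma exists_blinfun_vanishing:
  fixes F :: "'a::real_normed_vector set"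
  assumes inf: "\<nexists>B :: 'a set. finite B \<and> span B = UNIV" and F: "finite F"
  obtains f :: "'a \<Rightarrow>\<^sub>L real" where "norm f = 1" "\<And>u. u \<in> F \<Longrightarrow> f u = 0"
proof -
  obtain x0 where x0: "x0 \<notin> span F" using inf F by blast
  obtain q where q: "linear q" "q \<le> (\<lambda>x. infdist x (span F))" "q x0 = infdist x0 (span F)"
    using Hahn_Banach_sublinear[OF sublinear_infdist[OF subspace_span]] by blast
  have qle: "q x \<le> infdist x (span F)" for x using q(2) by (simp add: le_fun_def)
  have "q x0 > 0"
    unfolding q(3) using x0 closed_span_finite[OF F] span_zero[of F]
    by (intro infdist_pos_not_in_closed) auto
  have le: "q x \<le> norm x" for x
    using qle[of x] infdist_le[OF span_zero, of x F] by simp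
  have "\<bar>q x\<bar> \<le> norm x" for x
    using le[of x] le[of "- x"] linear_neg[OF q(1), of x] by simp
  then have bl: "bounded_linear q"
    using q(1) by (auto simp: bounded_linear_def bounded_linear_axioms_def intro!: exI[of _ 1])
  define g where "g = Blinfun q"
  have g: "blinfun_apply g = q" using bl by (simp add: g_def bounded_linear_Blinfun_apply)
  have van: "g u = 0" if "u \<in> F" for u
  proof -
    have "u \<in> span F" "- u \<in> span F" using that by (auto intro: span_base span_neg)
    then show ?thesis using qle[of u] qle[of "- u"] linear_neg[OF q(1), of u] by (simp add: g)
  qed
  have "g \<noteq> 0" using \<open>q x0 > 0\<close> g by auto
  then show ?thesis using van by (intro that[of "g /\<^sub>R norm g"]) (simp_all add: blinfun.scaleR_left)
qed

section \<open>Norming sets and Mazur sequences\<close>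

lemma exists_point_near_norm:
  fixes f :: "'a::real_normed_vector \<Rightarrow>\<^sub>L real"
  assumes "0 \<le> c" "c < norm f"
  obtains u where "norm u \<le> 1" "c < \<bar>f u\<bar>"
proof -
  have "\<exists>u. norm u \<le> 1 \<and> c < \<bar>f u\<bar>"
  proof (rule ccontr)
    assume "\<not> ?thesis"
    then have *: "\<bar>f u\<bar> \<le> c" if "norm u \<le> 1" for u using that not_less by blast
    have "norm (f x) \<le> c * norm x" for x
    proof (cases "x = 0")
      case False
      then have "\<bar>f (x /\<^sub>R norm x)\<bar> \<le> c" using *[of "x /\<^sub>R norm x"] by simp
      moreover have "\<bar>f (x /\<^sub>R norm x)\<bar> = \<bar>f x\<bar> / norm x"
        by (simp add: blinfun.scaleR_right abs_mult divide_inverse mult.commute)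
      ultimately show ?thesis using False by (simp add: pos_divide_le_eq)
    qed (simp add: blinfun.zero_right)
    then have "norm f \<le> c" using assms(1) by (intro norm_blinfun_bound)
    then show False using assms(2) by simp
  qed
  then show ?thesis using that by blast
qed

lemma abs_blinfun_le:
  fixes f :: "'a::real_normed_vector \<Rightarrow>\<^sub>L real"
  assumes "norm u \<le> 1"
  shows "\<bar>f u\<bar> \<le> norm f"
proof -
  have "norm (f u) \<le> norm f * norm u" by (rule norm_blinfun)
  also have "\<dots> \<le> norm f * 1" using assms by (intro mult_left_mono) auto
  finally show ?thesis by simp
qed

text \<open>The unit sphere of \<open>span E\<close> is compact. Each centre of a finite cover by
  balls of radius 1/4 exceeds 3/4 at some point of the unit ball, so every functional on the sphere
  exceeds 3/4 - 1/4 = 1/2 at one of these points; hence the factor 2. Quantifying over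
  \<open>r\<close> replaces a maximum over \<open>N\<close>, which may be empty.\<close>

lemma exists_finite_norming_set:
  fixes E :: "('a::real_normed_vector \<Rightarrow>\<^sub>L real) set"
  assumes "finite E"
  shows "\<exists>N. finite N \<and> N \<subseteq> cball 0 1 \<and>
    (\<forall>e\<in>span E. \<forall>r\<ge>0. (\<forall>u\<in>N. \<bar>blinfun_apply e u\<bar> \<le> r) \<longrightarrow> norm e \<le> 2 * r)"
proof -
  define S where "S = (span E \<inter> cball 0 1) \<inter> sphere 0 1"
  have "closed (sphere 0 1 :: ('a \<Rightarrow>\<^sub>L real) set)"
    unfolding sphere_def by (intro closed_Collect_eq continuous_intros)
  then have "compact S"
    unfolding S_def using compact_span_Int_cball[OF assms] by (intro compact_Int_closed[of "_ \<inter> cball 0 1"])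
  moreover have "S \<subseteq> (\<Union>c\<in>S. ball c (1/4))" by force
  ultimately obtain C where C: "C \<subseteq> S" "finite C" "S \<subseteq> (\<Union>c\<in>C. ball c (1/4))"
    using compactE_image[of S S "\<lambda>c. ball c (1/4)"] open_ball by metis
  have "\<exists>u. norm u \<le> 1 \<and> 3/4 < \<bar>blinfun_apply c u\<bar>" if "c \<in> C" for c
    by (rule exists_point_near_norm[of "3/4" c]) (use that C in \<open>auto simp: S_def\<close>)
  then obtain u where u: "\<And>c. c \<in> C \<Longrightarrow> norm (u c) \<le> 1 \<and> 3/4 < \<bar>blinfun_apply c (u c)\<bar>"
    by metis
  have "norm e \<le> 2 * r" if e: "e \<in> span E" and r: "r \<ge> 0" "\<forall>v\<in>u ` C. \<bar>blinfun_apply e v\<bar> \<le> r" for e r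
  proof (cases "e = 0")
    case False
    define e' where "e' = e /\<^sub>R norm e"
    have "e' \<in> S" using e False by (auto simp: S_def e'_def intro: span_scale)
    then obtain c where c: "c \<in> C" "dist c e' < 1/4" using C(3) by auto
    have uc: "norm (u c) \<le> 1" "3/4 < \<bar>c (u c)\<bar>" using u[OF c(1)] by auto
    have "\<bar>(c - e') (u c)\<bar> \<le> norm (c - e')" by (rule abs_blinfun_le[OF uc(1)])
    then have "\<bar>e' (u c)\<bar> > 1/2" using uc(2) c(2) by (simp add: blinfun.diff_left dist_norm)
    moreover have "e' (u c) = e (u c) / norm e" by (simp add: e'_def blinfun.scaleR_left field_simps)
    ultimately have "norm e < 2 * \<bar>e (u c)\<bar>" using False by (simp add: field_simps)
    also have "\<dots> \<le> 2 * r" using r(2) c(1) by simp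
    finally show ?thesis by simp
  qed (use r in simp)
  moreover have "finite (u ` C)" "u ` C \<subseteq> cball 0 1" using C u by auto
  ultimately show ?thesis by blast
qed

text \<open>Each functional is chosen to vanish on norming sets for the spans of all earlier initial
  segments. A limit of convex combinations of tails then vanishes on every \<open>N m\<close>,
  although these sets control the norm on the whole span of the sequence.\<close>

lemma exists_Mazur_sequence:
  assumes inf: "\<nexists>B :: 'a::real_normed_vector set. finite B \<and> span B = UNIV"
  obtains f :: "nat \<Rightarrow> 'a::real_normed_vector \<Rightarrow>\<^sub>L real" and N :: "nat \<Rightarrow> 'a set"
  where "\<And>n. norm (f n) = 1" "\<And>m. N m \<subseteq> cball 0 1"
    "\<And>m n u. m \<le> n \<Longrightarrow> u \<in> N m \<Longrightarrow> f n u = 0"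
    "\<And>m e r. e \<in> span (f ` {..<m}) \<Longrightarrow> r \<ge> 0 \<Longrightarrow> (\<And>u. u \<in> N m \<Longrightarrow> \<bar>blinfun_apply e u\<bar> \<le> r) \<Longrightarrow> norm e \<le> 2 * r"
proof -
  define M where "M = (\<lambda>E :: ('a \<Rightarrow>\<^sub>L real) set. SOME N. finite N \<and> N \<subseteq> cball 0 1 \<and>
      (\<forall>e\<in>span E. \<forall>r\<ge>0. (\<forall>u\<in>N. \<bar>blinfun_apply e u\<bar> \<le> r) \<longrightarrow> norm e \<le> 2 * r))"
  have M: "finite (M E) \<and> M E \<subseteq> cball 0 1 \<and>
      (\<forall>e\<in>span E. \<forall>r\<ge>0. (\<forall>u\<in>M E. \<bar>blinfun_apply e u\<bar> \<le> r) \<longrightarrow> norm e \<le> 2 * r)"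
    if "finite E" for E :: "('a \<Rightarrow>\<^sub>L real) set"
    unfolding M_def by (rule someI_ex) (rule exists_finite_norming_set[OF that])
  \<comment> \<open>Only the values of \<open>f\<close> below \<open>n\<close> enter, as
    well-founded choice requires; \<open>M\<close> is a function of the set of these values.\<close>
  define P where "P = (\<lambda>f n (r :: 'a \<Rightarrow>\<^sub>L real).
    norm r = 1 \<and> (\<forall>m\<le>n::nat. \<forall>u\<in>M (f ` {..<m}). blinfun_apply r u = 0))"
  have "\<exists>f. \<forall>n. P f n (f n)"
  proof (rule dependent_wellorder_choice)
    fix r :: "'a \<Rightarrow>\<^sub>L real" and f g :: "nat \<Rightarrow> 'a \<Rightarrow>\<^sub>L real" and n
    assume eq: "\<And>y. y < n \<Longrightarrow> f y = g y"
    have "f ` {..<m} = g ` {..<m}" if "m \<le> n" for m 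
    proof (rule image_cong[OF refl])
      fix k assume "k \<in> {..<m}"
      then show "f k = g k" using that eq[of k] by simp
    qed
    then show "P f n r = P g n r" unfolding P_def by simp
  next
    fix f :: "nat \<Rightarrow> 'a \<Rightarrow>\<^sub>L real" and n
    have "finite (\<Union>m\<le>n. M (f ` {..<m}))" using M by simp
    then obtain r :: "'a \<Rightarrow>\<^sub>L real" where "norm r = 1" "\<And>u. u \<in> (\<Union>m\<le>n. M (f ` {..<m})) \<Longrightarrow> r u = 0"
      using exists_blinfun_vanishing[OF inf] by blast
    then show "\<exists>r. P f n r" unfolding P_def by (intro exI[of _ r]) auto
  qed
  then obtain f where f: "\<And>n. P f n (f n)" by blast
  show ?thesis
  proof (rule that[of f "\<lambda>m. M (f ` {..<m})"])
    fix m e r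
    assume "e \<in> span (f ` {..<m})" "0 \<le> r" "\<And>u. u \<in> M (f ` {..<m}) \<Longrightarrow> \<bar>blinfun_apply e u\<bar> \<le> r"
    then show "norm e \<le> 2 * r" using M[of "f ` {..<m}"] by simp
  qed (use f M in \<open>auto simp: P_def\<close>)
qed

section \<open>Convex blocks and oscillation\<close>

text \<open>The convex combinations need not have successive supports: only their tails matter, and this
  weaker notion is transitive and stable under diagonal sequences.\<close>

definition convex_blocks :: "(nat \<Rightarrow> 'a::real_vector) \<Rightarrow> (nat \<Rightarrow> 'a) \<Rightarrow> bool" where
  "convex_blocks h g \<longleftrightarrow> (\<forall>n. h n \<in> convex hull (g ` {n..}))"

lemma convex_blocksD: "convex_blocks h g \<Longrightarrow> h n \<in> convex hull (g ` {n..})"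
  by (simp add: convex_blocks_def)

lemma convex_blocks_refl: "convex_blocks g g"
  by (auto simp: convex_blocks_def intro: hull_inc)

lemma convex_blocks_hull:
  assumes "convex_blocks h g" "n \<le> m"
  shows "h m \<in> convex hull (g ` {n..})"
  using convex_blocksD[OF assms(1), of m] hull_mono[of "g ` {m..}" "g ` {n..}" convex] assms(2)
  by (auto simp: image_mono)

lemma convex_blocks_trans:
  assumes "convex_blocks k h" "convex_blocks h g"
  shows "convex_blocks k g"
  unfolding convex_blocks_def
proof
  fix n
  have "convex hull (h ` {n..}) \<subseteq> convex hull (g ` {n..})"
    using convex_blocks_hull[OF assms(2)] by (intro hull_minimal) auto
  then show "k n \<in> convex hull (g ` {n..})" using convex_blocksD[OF assms(1), of n] by blast
qed

lemma convex_blocks_midpoint: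
  assumes "convex_blocks h g" "strict_mono r" "strict_mono s"
  shows "convex_blocks (\<lambda>n. (1/2) *\<^sub>R h (r n) + (1/2) *\<^sub>R h (s n)) g"
  unfolding convex_blocks_def
proof
  fix n
  have "h (r n) \<in> convex hull (g ` {n..})" "h (s n) \<in> convex hull (g ` {n..})"
    using assms by (auto intro: convex_blocks_hull seq_suble)
  then show "(1/2) *\<^sub>R h (r n) + (1/2) *\<^sub>R h (s n) \<in> convex hull (g ` {n..})"
    by (intro convexD convex_convex_hull) auto
qed

lemma norm_convex_blocks_le:
  fixes g :: "nat \<Rightarrow> 'a::real_normed_vector"
  assumes "convex_blocks h g" "\<And>n. norm (g n) \<le> b"
  shows "norm (h n) \<le> b"
proof -
  have "convex hull (g ` {n..}) \<subseteq> cball 0 b" using assms(2) by (intro hull_minimal) auto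
  then show ?thesis using convex_blocksD[OF assms(1), of n] by auto
qed

text \<open>Evaluation at \<open>x\<close> is linear, so the functionals whose value lies in
  \<open>C\<close> form a convex set, which contains the hull of the tail.\<close>

lemma convex_blocks_apply:
  fixes g :: "nat \<Rightarrow> 'a::real_normed_vector \<Rightarrow>\<^sub>L real"
  assumes "convex_blocks h g" "convex C" "\<And>m. m \<ge> n \<Longrightarrow> g m x \<in> C"
  shows "h n x \<in> C"
proof -
  have "linear (\<lambda>\<phi> :: 'a \<Rightarrow>\<^sub>L real. \<phi> x)"
    by (intro linearI) (simp_all add: blinfun.add_left blinfun.scaleR_left)
  then have "convex ((\<lambda>\<phi> :: 'a \<Rightarrow>\<^sub>L real. \<phi> x) -` C)" using assms(2) by (rule convex_linear_vimage)
  then have "convex hull (g ` {n..}) \<subseteq> (\<lambda>\<phi>. blinfun_apply \<phi> x) -` C" using assms(3) by (intro hull_minimal) auto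
  then show ?thesis using convex_blocksD[OF assms(1), of n] by auto
qed

text \<open>The parameter is half of the gap around the level \<open>b\<close>: half the difference
  of a high and a low value of \<open>s\<close> is then at least \<open>\<delta>\<close>.\<close>

definition oscillates :: "(nat \<Rightarrow> real) \<Rightarrow> real \<Rightarrow> bool" where
  "oscillates s \<delta> \<longleftrightarrow> (\<exists>b. (\<exists>\<^sub>\<infinity>n. b + \<delta> \<le> s n) \<and> (\<exists>\<^sub>\<infinity>n. s n \<le> b - \<delta>))"

text \<open>If a tail of \<open>g\<close> at \<open>x\<close> stayed strictly on one side of a
  level, so would all its convex combinations. Thus blocks create no oscillation, and what one stage
  of a diagonal construction achieves is kept by later stages.\<close>

lemma oscillates_convex_blocks:
  fixes g :: "nat \<Rightarrow> 'a::real_normed_vector \<Rightarrow>\<^sub>L real"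
  assumes hg: "convex_blocks h g" and osc: "oscillates (\<lambda>n. h n x) \<delta>"
  shows "oscillates (\<lambda>n. g n x) \<delta>"
proof -
  obtain b where b: "\<exists>\<^sub>\<infinity>n. b + \<delta> \<le> h n x" "\<exists>\<^sub>\<infinity>n. h n x \<le> b - \<delta>"
    using osc by (auto simp: oscillates_def)
  have "\<exists>m\<ge>k. b + \<delta> \<le> g m x" for k
  proof (rule ccontr)
    assume no: "\<not> ?thesis"
    obtain n where n: "n \<ge> k" "b + \<delta> \<le> h n x" using b(1) by (auto simp: INFM_nat_le)
    have "g m x < b + \<delta>" if "m \<ge> n" for m using no n(1) that by (meson not_less order_trans)
    then have "h n x \<in> {..<b + \<delta>}" by (intro convex_blocks_apply[OF hg]) auto
    then show False using n(2) by simp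
  qed
  moreover have "\<exists>m\<ge>k. g m x \<le> b - \<delta>" for k
  proof (rule ccontr)
    assume no: "\<not> ?thesis"
    obtain n where n: "n \<ge> k" "h n x \<le> b - \<delta>" using b(2) by (auto simp: INFM_nat_le)
    have "b - \<delta> < g m x" if "m \<ge> n" for m using no n(1) that by (meson not_less order_trans)
    then have "h n x \<in> {b - \<delta><..}" by (intro convex_blocks_apply[OF hg]) auto
    then show False using n(2) by simp
  qed
  ultimately show ?thesis unfolding oscillates_def INFM_nat_le by blast
qed

lemma INFM_subsequence:
  assumes "\<exists>\<^sub>\<infinity>n. P n"
  shows "\<exists>r :: nat \<Rightarrow> nat. strict_mono r \<and> (\<forall>n. P (r n))"
  using infinite_enumerate[of "{n. P n}"] assms by (auto simp: frequently_cofinite)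

lemma oscillates_mono:
  assumes "oscillates s \<delta>" "\<epsilon> \<le> \<delta>"
  shows "oscillates s \<epsilon>"
proof -
  obtain b where b: "\<exists>\<^sub>\<infinity>n. b + \<delta> \<le> s n" "\<exists>\<^sub>\<infinity>n. s n \<le> b - \<delta>"
    using assms(1) by (auto simp: oscillates_def)
  have "\<exists>\<^sub>\<infinity>n. b + \<epsilon> \<le> s n" using b(1) by (rule frequently_elim1) (use assms(2) in simp)
  moreover have "\<exists>\<^sub>\<infinity>n. s n \<le> b - \<epsilon>" using b(2) by (rule frequently_elim1) (use assms(2) in simp)
  ultimately show ?thesis unfolding oscillates_def by blast
qed

lemma oscillates_shift: "oscillates s \<delta> \<Longrightarrow> oscillates (\<lambda>n. s (n + j)) \<delta>"
proof -
  assume "oscillates s \<delta>"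
  then obtain b where b: "\<exists>\<^sub>\<infinity>n. b + \<delta> \<le> s n" "\<exists>\<^sub>\<infinity>n. s n \<le> b - \<delta>"
    by (auto simp: oscillates_def)
  have "\<exists>n\<ge>k. b + \<delta> \<le> s (n + j)" for k
    using b(1) unfolding INFM_nat_le by (metis add_le_imp_le_right le_add2 le_add_diff_inverse2 order_trans)
  moreover have "\<exists>n\<ge>k. s (n + j) \<le> b - \<delta>" for k
    using b(2) unfolding INFM_nat_le by (metis add_le_imp_le_right le_add2 le_add_diff_inverse2 order_trans)
  ultimately show ?thesis unfolding oscillates_def INFM_nat_le by blast
qed

text \<open>Boundedness gives a subsequential limit \<open>l\<close>. If \<open>s\<close> does not
  converge to \<open>l\<close>, it is infinitely often close to \<open>l\<close> and infinitely
  often at least \<open>e\<close> away on one fixed side.\<close>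

lemma convergent_if_not_oscillates:
  fixes s :: "nat \<Rightarrow> real"
  assumes bdd: "\<And>n. \<bar>s n\<bar> \<le> B" and no: "\<And>\<delta>. \<delta> > 0 \<Longrightarrow> \<not> oscillates s \<delta>"
  shows "convergent s"
proof -
  have bnd: "bounded (range s)" using bdd by (auto simp: bounded_iff)
  then obtain l r where r: "strict_mono r" "(s \<circ> r) \<longlonglongrightarrow> l"
    using bounded_imp_convergent_subsequence by blast
  have "s \<longlonglongrightarrow> l"
  proof (rule ccontr)
    assume "\<not> ?thesis"
    then obtain e where e: "e > 0" "\<exists>\<^sub>\<infinity>n. e \<le> \<bar>s n - l\<bar>"
      unfolding lim_sequentially dist_real_def INFM_nat_le by (metis not_less)
    have near: "\<exists>\<^sub>\<infinity>n. \<bar>s n - l\<bar> < e/3"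
      unfolding INFM_nat_le
    proof
      fix k
      obtain m where "\<And>n. n \<ge> m \<Longrightarrow> \<bar>s (r n) - l\<bar> < e/3"
        using r(2) e(1) unfolding lim_sequentially dist_real_def o_def
        by (metis divide_pos_pos zero_less_numeral)
      then show "\<exists>n\<ge>k. \<bar>s n - l\<bar> < e/3"
        using seq_suble[OF r(1), of "max k m"] by (intro exI[of _ "r (max k m)"]) auto
    qed
    have "\<exists>\<^sub>\<infinity>n. l + e \<le> s n \<or> s n \<le> l - e"
      using e(2) by (rule frequently_elim1) auto
    then consider "\<exists>\<^sub>\<infinity>n. l + e \<le> s n" | "\<exists>\<^sub>\<infinity>n. s n \<le> l - e"
      by (auto simp: frequently_disj_iff)
    then have "oscillates s (e/3)"
    proof cases
      case 1
      \<comment> \<open>The level is the midpoint between \<open>l + e/3\<close> and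
        \<open>l + e\<close>.\<close>
      have "\<exists>\<^sub>\<infinity>n. (l + 2 * e/3) + e/3 \<le> s n" using 1 by (rule frequently_elim1) (use e in simp)
      moreover have "\<exists>\<^sub>\<infinity>n. s n \<le> (l + 2 * e/3) - e/3" using near by (rule frequently_elim1) linarith
      ultimately show ?thesis unfolding oscillates_def by blast
    next
      case 2
      have "\<exists>\<^sub>\<infinity>n. s n \<le> (l - 2 * e/3) - e/3" using 2 by (rule frequently_elim1) (use e in simp)
      moreover have "\<exists>\<^sub>\<infinity>n. (l - 2 * e/3) + e/3 \<le> s n" using near by (rule frequently_elim1) linarith
      ultimately show ?thesis unfolding oscillates_def by blast
    qed
    then show False using no[of "e/3"] e by simp
  qed
  then show ?thesis by (rule convergentI)
qed

lemma sq_half_add_le: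
  fixes a b :: real
  shows "((1/2) * a + (1/2) * b)\<^sup>2 \<le> (1/2) * a\<^sup>2 + (1/2) * b\<^sup>2"
proof -
  have "(1/2) * a\<^sup>2 + (1/2) * b\<^sup>2 - ((1/2) * a + (1/2) * b)\<^sup>2 = ((1/2) * (a - b))\<^sup>2"
    by (simp add: power2_eq_square field_simps)
  then show ?thesis by (metis diff_ge_0_iff_ge zero_le_power2)
qed

lemma sq_half_add_sq_half_diff:
  fixes a b :: real
  shows "((1/2) * a + (1/2) * b)\<^sup>2 + ((1/2) * a - (1/2) * b)\<^sup>2 = (1/2) * a\<^sup>2 + (1/2) * b\<^sup>2"
  by (simp add: power2_eq_square field_simps)

section \<open>Bessel systems\<close>

text \<open>An oscillating sequence \<open>h\<close> is split along two subsequences \<open>p\<close> and \<open>q\<close>; the half sum of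
  \<open>h \<circ> p\<close> and \<open>h \<circ> q\<close> replaces \<open>h\<close> and their half difference is the new functional. By the
  parallelogram law this preserves the bound \<open>(h n z)\<^sup>2 + (\<Sum>j. (\<phi> j n z)\<^sup>2) \<le> (norm z)\<^sup>2\<close>.\<close>

lemma exists_finite_Bessel_system:
  fixes g :: "nat \<Rightarrow> 'a::real_normed_vector \<Rightarrow>\<^sub>L real"
  assumes g: "\<And>n. norm (g n) \<le> 1"
    and osc: "\<And>h. convex_blocks h g \<Longrightarrow> \<exists>x. norm x \<le> 1 \<and> oscillates (\<lambda>n. h n x) \<delta>"
  obtains y where "\<And>j. norm (y j) \<le> 1"
    "\<And>K. \<exists>\<phi> :: nat \<Rightarrow> 'a \<Rightarrow>\<^sub>L real. (\<forall>z. (\<Sum>j<K. (\<phi> j z)\<^sup>2) \<le> (norm z)\<^sup>2) \<and> (\<forall>j<K. \<delta> \<le> \<phi> j (y j))"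
proof -
  \<comment> \<open>A state consists of the current blocks \<open>h\<close>, functionals
    \<open>\<phi> j n\<close> that are averaged again at every stage, and test points
    \<open>x j\<close> that stay fixed once chosen, as \<open>Q\<close> records. The bounds hold for
    all \<open>n\<close> because the next stage averages entries with different indices.\<close>
  define P where "P = (\<lambda>K (h, \<phi>, x :: nat \<Rightarrow> 'a). convex_blocks h g \<and>
    (\<forall>n z. (blinfun_apply (h n) z)\<^sup>2 + (\<Sum>j<K. (blinfun_apply (\<phi> j n) z)\<^sup>2) \<le> (norm z)\<^sup>2) \<and>
    (\<forall>j<K::nat. norm (x j) \<le> 1 \<and> (\<forall>n::nat. \<delta> \<le> blinfun_apply (\<phi> j n) (x j))))"
  define Q where "Q = (\<lambda>K (h :: nat \<Rightarrow> 'a \<Rightarrow>\<^sub>L real, \<phi> :: nat \<Rightarrow> nat \<Rightarrow> 'a \<Rightarrow>\<^sub>L real, x :: nat \<Rightarrow> 'a)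
    (h' :: nat \<Rightarrow> 'a \<Rightarrow>\<^sub>L real, \<phi>' :: nat \<Rightarrow> nat \<Rightarrow> 'a \<Rightarrow>\<^sub>L real, x'). \<forall>j<K::nat. x' j = x j)"
  have "\<exists>s. \<forall>K. P K (s K) \<and> Q K (s K) (s (Suc K))"
  proof (rule dependent_nat_choice)
    have "(g n z)\<^sup>2 \<le> (norm z)\<^sup>2" for n z
    proof -
      have "norm (g n z) \<le> norm (g n) * norm z" by (rule norm_blinfun)
      also have "\<dots> \<le> 1 * norm z" using g by (intro mult_right_mono) auto
      finally show ?thesis using power_mono[of "norm (g n z)" "norm z" 2] by simp
    qed
    then have "P 0 (g, \<lambda>_ _. 0, \<lambda>_. 0)" by (simp add: P_def convex_blocks_refl)
    then show "\<exists>s. P 0 s" by blast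
  next
    fix s K assume "P K s"
    moreover obtain h \<phi> x where s: "s = (h, \<phi>, x)" by (cases s)
    ultimately have h: "convex_blocks h g"
      and sq: "\<And>n z. (h n z)\<^sup>2 + (\<Sum>j<K. (blinfun_apply (\<phi> j n) z)\<^sup>2) \<le> (norm z)\<^sup>2"
      and x: "\<And>j. j < K \<Longrightarrow> norm (x j) \<le> 1" "\<And>j n. j < K \<Longrightarrow> \<delta> \<le> \<phi> j n (x j)"
      by (auto simp: P_def)
    obtain w b where w: "norm w \<le> 1" "\<exists>\<^sub>\<infinity>n. b + \<delta> \<le> h n w" "\<exists>\<^sub>\<infinity>n. h n w \<le> b - \<delta>"
      using osc[OF h] by (auto simp: oscillates_def)
    obtain p :: "nat \<Rightarrow> nat" where p: "strict_mono p" "\<And>n. b + \<delta> \<le> h (p n) w"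
      using INFM_subsequence[OF w(2)] by blast
    obtain q :: "nat \<Rightarrow> nat" where q: "strict_mono q" "\<And>n. h (q n) w \<le> b - \<delta>"
      using INFM_subsequence[OF w(3)] by blast
    define h' where "h' = (\<lambda>n. (1/2) *\<^sub>R h (p n) + (1/2) *\<^sub>R h (q n))"
    define \<phi>' where "\<phi>' = (\<lambda>j n. if j < K then (1/2) *\<^sub>R \<phi> j (p n) + (1/2) *\<^sub>R \<phi> j (q n)
      else (1/2) *\<^sub>R h (p n) - (1/2) *\<^sub>R h (q n))"
    have "(h' n z)\<^sup>2 + (\<Sum>j<Suc K. (\<phi>' j n z)\<^sup>2) \<le> (norm z)\<^sup>2" for n z
    proof -
      \<comment> \<open>Old functionals are handled by convexity of the square, the new half sum and
        half difference by the parallelogram law; together they give the average of the bounds at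
        \<open>p n\<close> and \<open>q n\<close>.\<close>
      have "(\<Sum>j<K. (\<phi>' j n z)\<^sup>2) \<le> (\<Sum>j<K. (1/2) * (\<phi> j (p n) z)\<^sup>2 + (1/2) * (\<phi> j (q n) z)\<^sup>2)"
      proof (rule sum_mono)
        fix j assume "j \<in> {..<K}"
        then show "(\<phi>' j n z)\<^sup>2 \<le> (1/2) * (\<phi> j (p n) z)\<^sup>2 + (1/2) * (\<phi> j (q n) z)\<^sup>2"
          using sq_half_add_le[of "\<phi> j (p n) z" "\<phi> j (q n) z"]
          by (simp add: \<phi>'_def blinfun.add_left blinfun.scaleR_left)
      qed
      also have "\<dots> = (1/2) * (\<Sum>j<K. (\<phi> j (p n) z)\<^sup>2) + (1/2) * (\<Sum>j<K. (\<phi> j (q n) z)\<^sup>2)"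
        by (simp only: sum.distrib sum_distrib_left)
      finally have "(\<Sum>j<K. (\<phi>' j n z)\<^sup>2) \<le> \<dots>" .
      moreover have "(h' n z)\<^sup>2 + (\<phi>' K n z)\<^sup>2 = (1/2) * (h (p n) z)\<^sup>2 + (1/2) * (h (q n) z)\<^sup>2"
        using sq_half_add_sq_half_diff[of "h (p n) z" "h (q n) z"]
        by (simp add: h'_def \<phi>'_def blinfun.add_left blinfun.diff_left blinfun.scaleR_left)
      ultimately show ?thesis using sq[of "p n" z] sq[of "q n" z] by simp
    qed
    moreover have "convex_blocks h' g" unfolding h'_def by (rule convex_blocks_midpoint[OF h p(1) q(1)])
    moreover have "norm ((x(K := w)) j) \<le> 1" if "j < Suc K" for j
      using that x w by (auto simp: less_Suc_eq)
    moreover have "\<delta> \<le> \<phi>' j n ((x(K := w)) j)" if "j < Suc K" for j n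
    proof (cases "j = K")
      case True
      then show ?thesis using p(2)[of n] q(2)[of n]
        by (simp add: \<phi>'_def blinfun.diff_left blinfun.scaleR_left)
    next
      case False
      then have "j < K" using that by simp
      then show ?thesis using x(2)[of j "p n"] x(2)[of j "q n"]
        by (simp add: \<phi>'_def blinfun.add_left blinfun.scaleR_left)
    qed
    ultimately have "P (Suc K) (h', \<phi>', x(K := w))" by (simp add: P_def)
    moreover have "Q K s (h', \<phi>', x(K := w))" by (simp add: Q_def s)
    ultimately show "\<exists>s'. P (Suc K) s' \<and> Q K s s'" by blast
  qed
  then obtain s where s: "\<And>K. P K (s K)" "\<And>K. Q K (s K) (s (Suc K))" by blast
  define x where "x = (\<lambda>K. snd (snd (s K)))"
  \<comment> \<open>Point \<open>j\<close> enters at stage \<open>Suc j\<close> and never changes,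
    so one sequence \<open>y\<close> serves every \<open>K\<close>, whereas the functionals depend
    on \<open>K\<close>.\<close>
  define y where "y = (\<lambda>j. x (Suc j) j)"
  have stable: "x (Suc K) j = x K j" if "j < K" for j K
    using s(2)[of K] that by (auto simp: Q_def x_def case_prod_unfold)
  have xy: "x K j = y j" if "Suc j \<le> K" for j K
    using that
  proof (induction K rule: dec_induct)
    case (step m)
    then show ?case using stable[of j m] by simp
  qed (simp add: y_def)
  show ?thesis
  proof (rule that[of y])
    show "norm (y j) \<le> 1" for j
      using s(1)[of "Suc j"] by (auto simp: P_def case_prod_unfold y_def x_def)
    fix K
    obtain h \<phi> where hp: "s K = (h, \<phi>, x K)" by (cases "s K") (auto simp: x_def)
    have sq: "(h 0 z)\<^sup>2 + (\<Sum>j<K. (blinfun_apply (\<phi> j 0) z)\<^sup>2) \<le> (norm z)\<^sup>2" for z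
      using s(1)[of K] by (auto simp: P_def hp)
    have "(\<Sum>j<K. (blinfun_apply (\<phi> j 0) z)\<^sup>2) \<le> (norm z)\<^sup>2" for z
      using sq[of z] zero_le_power2[of "h 0 z"] by linarith
    moreover have "\<delta> \<le> \<phi> j 0 (y j)" if "j < K" for j
      using s(1)[of K] that xy[of j K] by (auto simp: P_def hp)
    ultimately show "\<exists>\<phi> :: nat \<Rightarrow> 'a \<Rightarrow>\<^sub>L real. (\<forall>z. (\<Sum>j<K. (\<phi> j z)\<^sup>2) \<le> (norm z)\<^sup>2) \<and> (\<forall>j<K. \<delta> \<le> \<phi> j (y j))"
      by (intro exI[of _ "\<lambda>j. \<phi> j 0"]) auto
  qed
qed

text \<open>Passage to the limit \<open>K \<longrightarrow> \<infinity>\<close> by compactness of a product of intervals.\<close>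

lemma exists_Bessel_system:
  fixes y :: "nat \<Rightarrow> 'a::real_normed_vector"
  assumes fin: "\<And>K. \<exists>\<phi> :: nat \<Rightarrow> 'a \<Rightarrow>\<^sub>L real.
    (\<forall>z. (\<Sum>j<K. (\<phi> j z)\<^sup>2) \<le> (norm z)\<^sup>2) \<and> (\<forall>j<K. \<delta> \<le> \<phi> j (y j))"
  obtains \<phi> :: "nat \<Rightarrow> 'a \<Rightarrow>\<^sub>L real"
  where "\<And>K z. (\<Sum>j<K. (\<phi> j z)\<^sup>2) \<le> (norm z)\<^sup>2" "\<And>j. \<delta> \<le> \<phi> j (y j)"
proof -
  define X :: "(nat \<times> 'a \<Rightarrow> real) set" where "X = PiE UNIV (\<lambda>(j, z). cball 0 (norm z))"
  \<comment> \<open>Each condition involves finitely many coordinates of \<open>F\<close>, so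
    \<open>S K\<close> is closed in the product topology. A member of all \<open>S K\<close> is
    linear in its second argument for every \<open>j\<close>.\<close>
  define S :: "nat \<Rightarrow> (nat \<times> 'a \<Rightarrow> real) set" where "S = (\<lambda>K. {F.
     (\<forall>j z w. j < K \<longrightarrow> F (j, z + w) = F (j, z) + F (j, w)) \<and>
     (\<forall>j c z. j < K \<longrightarrow> F (j, c *\<^sub>R z) = c * F (j, z)) \<and>
     (\<forall>z. (\<Sum>j<K. (F (j, z))\<^sup>2) \<le> (norm z)\<^sup>2) \<and> (\<forall>j. j < K \<longrightarrow> \<delta> \<le> F (j, y j))})"
  have mono: "S L \<subseteq> S K" if "K \<le> L" for K L
  proof -
    have le: "(\<Sum>j<K. (F (j, z))\<^sup>2) \<le> (\<Sum>j<L. (F (j, z))\<^sup>2)" for F :: "nat \<times> 'a \<Rightarrow> real" and z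
      using that by (intro sum_mono2) auto
    show ?thesis using that unfolding S_def by (auto intro: order_trans[OF le])
  qed
  have "compactin (product_topology (\<lambda>_. euclidean) UNIV) X"
    unfolding X_def compactin_PiE by auto
  then have "compact X" by (simp add: euclidean_product_topology)
  have cl: "closed (S K)" for K
    unfolding S_def
    by (intro closed_Collect_conj closed_Collect_all closed_Collect_imp closed_Collect_le
        closed_Collect_eq open_Collect_const continuous_intros continuous_on_product_coordinates)
  have ne: "X \<inter> S K \<noteq> {}" for K
  proof -
    obtain \<phi> :: "nat \<Rightarrow> 'a \<Rightarrow>\<^sub>L real" where \<phi>: "\<And>z. (\<Sum>j<K. (\<phi> j z)\<^sup>2) \<le> (norm z)\<^sup>2"
        "\<And>j. j < K \<Longrightarrow> \<delta> \<le> \<phi> j (y j)"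
      using fin by blast
    define F where "F = (\<lambda>(j, z). if j < K then \<phi> j z else 0)"
    have "F \<in> S K"
      using \<phi> by (auto simp: S_def F_def blinfun.add_right blinfun.scaleR_right)
    moreover have "\<bar>\<phi> j z\<bar> \<le> norm z" if "j < K" for j z
    proof -
      have "(\<phi> j z)\<^sup>2 \<le> (\<Sum>j<K. (\<phi> j z)\<^sup>2)" using that by (intro member_le_sum) auto
      also have "\<dots> \<le> (norm z)\<^sup>2" by (rule \<phi>)
      finally show ?thesis using abs_le_square_iff[of "\<phi> j z" "norm z"] by simp
    qed
    then have "F \<in> X" by (auto simp: X_def F_def)
    ultimately show ?thesis by blast
  qed
  have "X \<inter> (\<Inter>K. S K) \<noteq> {}"
  proof (rule compact_imp_fip_image[OF \<open>compact X\<close>])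
    fix I :: "nat set" assume "finite I"
    then obtain K where "\<And>k. k \<in> I \<Longrightarrow> k \<le> K" by (meson Max_ge)
    then have "X \<inter> S K \<subseteq> X \<inter> (\<Inter>k\<in>I. S k)" using mono by blast
    then show "X \<inter> (\<Inter>k\<in>I. S k) \<noteq> {}" using ne by blast
  qed (rule cl)
  then obtain F where F: "F \<in> X" "\<And>K. F \<in> S K" by blast
  have bl: "bounded_linear (\<lambda>z. F (j, z))" for j
  proof (rule bounded_linear_intro[where K = 1])
    show "F (j, x + y) = F (j, x) + F (j, y)" for x y using F(2)[of "Suc j"] by (simp add: S_def)
    show "F (j, r *\<^sub>R x) = r *\<^sub>R F (j, x)" for r x using F(2)[of "Suc j"] by (simp add: S_def)
    show "norm (F (j, x)) \<le> norm x * 1" for x using F(1) by (auto simp: X_def PiE_def Pi_def)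
  qed
  define \<phi> where "\<phi> = (\<lambda>j. Blinfun (\<lambda>z. F (j, z)))"
  have \<phi>: "blinfun_apply (\<phi> j) z = F (j, z)" for j z
    using bl by (simp add: \<phi>_def bounded_linear_Blinfun_apply)
  show ?thesis
  proof (rule that[of \<phi>])
    show "(\<Sum>j<K. (\<phi> j z)\<^sup>2) \<le> (norm z)\<^sup>2" for K z using F(2)[of K] by (simp add: S_def \<phi>)
    show "\<delta> \<le> \<phi> j (y j)" for j using F(2)[of "Suc j"] by (simp add: S_def \<phi>)
  qed
qed

lemma weak_star_null_if_Bessel:
  fixes \<phi> :: "nat \<Rightarrow> 'a::real_normed_vector \<Rightarrow>\<^sub>L real"
  assumes "\<And>K z. (\<Sum>j<K. (\<phi> j z)\<^sup>2) \<le> (norm z)\<^sup>2"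
  shows "weak_star_null \<phi>"
  unfolding weak_star_null_def
proof
  fix z
  have "summable (\<lambda>j. (\<phi> j z)\<^sup>2)" using assms by (intro summableI_nonneg_bounded) auto
  then have "(\<lambda>j. (\<phi> j z)\<^sup>2) \<longlonglongrightarrow> 0" by (rule summable_LIMSEQ_zero)
  then show "(\<lambda>j. \<phi> j z) \<longlonglongrightarrow> 0" using tendsto_real_sqrt by (fastforce simp: tendsto_rabs_zero_iff)
qed

section \<open>The Josefson--Nissenzweig theorem\<close>

text \<open>The negation, applied to subsequences, says that every weak* null sequence in the dual
  is norm null.\<close>

definition has_seminormalized_null_sequence :: "'a::real_normed_vector itself \<Rightarrow> bool" where
  "has_seminormalized_null_sequence _ \<longleftrightarrow>
    (\<exists>(\<phi> :: nat \<Rightarrow> 'a \<Rightarrow>\<^sub>L real) c. c > 0 \<and> weak_star_null \<phi> \<and> (\<forall>n. c \<le> norm (\<phi> n)))"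

text \<open>Persistent oscillation yields an infinite Bessel system. It is weak* null since its
  squares are summable at every point, and its norms are at least \<open>\<delta>\<close> since the
  \<open>y j\<close> lie in the unit ball.\<close>

lemma seminormalized_null_sequence_if_oscillates:
  fixes g :: "nat \<Rightarrow> 'a::real_normed_vector \<Rightarrow>\<^sub>L real"
  assumes g: "\<And>n. norm (g n) \<le> 1" and \<delta>: "\<delta> > 0"
    and osc: "\<And>h. convex_blocks h g \<Longrightarrow> \<exists>x. norm x \<le> 1 \<and> oscillates (\<lambda>n. h n x) \<delta>"
  shows "has_seminormalized_null_sequence TYPE('a)"
proof -
  obtain y where y: "\<And>j. norm (y j) \<le> 1"
    "\<And>K. \<exists>\<phi> :: nat \<Rightarrow> 'a \<Rightarrow>\<^sub>L real. (\<forall>z. (\<Sum>j<K. (\<phi> j z)\<^sup>2) \<le> (norm z)\<^sup>2) \<and> (\<forall>j<K. \<delta> \<le> \<phi> j (y j))"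
    using exists_finite_Bessel_system[of g \<delta>, OF g osc] by blast
  obtain \<phi> :: "nat \<Rightarrow> 'a \<Rightarrow>\<^sub>L real"
    where \<phi>: "\<And>K z. (\<Sum>j<K. (\<phi> j z)\<^sup>2) \<le> (norm z)\<^sup>2" "\<And>j. \<delta> \<le> \<phi> j (y j)"
    using exists_Bessel_system[OF y(2)] by blast
  have "\<delta> \<le> norm (\<phi> j)" for j using abs_blinfun_le[OF y(1)[of j], of "\<phi> j"] \<phi>(2)[of j] by linarith
  then show ?thesis
    using weak_star_null_if_Bessel[OF \<phi>(1)] \<delta> unfolding has_seminormalized_null_sequence_def by blast
qed

text \<open>Stage \<open>k\<close> passes to blocks that oscillate by
  \<open>1 / real (Suc k)\<close> at no point of the unit ball. From index \<open>k\<close> on, the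
  diagonal sequence consists of blocks of stage \<open>k\<close>, so it does not oscillate by any
  positive amount.\<close>

lemma exists_pointwise_convergent_convex_blocks:
  fixes f :: "nat \<Rightarrow> 'a::real_normed_vector \<Rightarrow>\<^sub>L real"
  assumes f: "\<And>n. norm (f n) \<le> 1" and no: "\<not> has_seminormalized_null_sequence TYPE('a)"
  obtains h where "convex_blocks h f" "\<And>x. convergent (\<lambda>n. h n x)"
proof -
  define R where "R = (\<lambda>k (g :: nat \<Rightarrow> 'a \<Rightarrow>\<^sub>L real) h. convex_blocks h g \<and>
    (\<forall>x. norm x \<le> 1 \<longrightarrow> \<not> oscillates (\<lambda>n. blinfun_apply (h n) x) (1 / real (Suc k))))"
  have "\<exists>s. \<forall>k. convex_blocks (s k) f \<and> R k (s k) (s (Suc k))"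
  proof (rule dependent_nat_choice)
    fix g :: "nat \<Rightarrow> 'a \<Rightarrow>\<^sub>L real" and k assume g: "convex_blocks g f"
    have "norm (g n) \<le> 1" for n by (rule norm_convex_blocks_le[OF g f])
    then obtain h where "R k g h"
      using seminormalized_null_sequence_if_oscillates[of g "1 / real (Suc k)"] no unfolding R_def by auto
    then show "\<exists>h. convex_blocks h f \<and> R k g h"
      using g convex_blocks_trans unfolding R_def by blast
  qed (use convex_blocks_refl in blast)
  then obtain s where s: "\<And>k. convex_blocks (s k) f" "\<And>k. R k (s k) (s (Suc k))" by blast
  have chain: "convex_blocks (s m) (s k)" if "k \<le> m" for k m
    using that
  proof (induction m rule: dec_induct)
    case (step m)
    then show ?case using s(2)[of m] convex_blocks_trans unfolding R_def by blast
  qed (rule convex_blocks_refl)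
  define h where "h = (\<lambda>n. s n n)"
  have hf: "convex_blocks h f" unfolding convex_blocks_def h_def using s(1) convex_blocksD by blast
  have tail: "convex_blocks (\<lambda>n. h (n + k)) (s k)" for k
    unfolding convex_blocks_def h_def
    using convex_blocks_hull[OF chain, of k "_ + k" _ "_ + k"] by (metis le_add1 le_add2)
  have ball: "convergent (\<lambda>n. h n x)" if x: "norm x \<le> 1" for x
  proof (rule convergent_if_not_oscillates)
    show "\<bar>h n x\<bar> \<le> 1" for n
      using abs_blinfun_le[OF x, of "h n"] norm_convex_blocks_le[OF hf f, of n] by linarith
    fix \<delta> :: real assume "\<delta> > 0"
    then obtain k where k: "1 / real (Suc k) < \<delta>" using nat_approx_posE by metis
    show "\<not> oscillates (\<lambda>n. h n x) \<delta>"
    proof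
      assume "oscillates (\<lambda>n. h n x) \<delta>"
      \<comment> \<open>The shift is \<open>Suc k\<close> because the sequence without oscillation
        of size \<open>1 / real (Suc k)\<close> is \<open>s (Suc k)\<close>.\<close>
      then have "oscillates (\<lambda>n. h (n + Suc k) x) \<delta>" by (rule oscillates_shift)
      then have "oscillates (\<lambda>n. s (Suc k) n x) \<delta>" using oscillates_convex_blocks[OF tail] by blast
      then have "oscillates (\<lambda>n. s (Suc k) n x) (1 / real (Suc k))"
        by (rule oscillates_mono) (use k in simp)
      then show False using s(2)[of k] x unfolding R_def by blast
    qed
  qed
  have "convergent (\<lambda>n. h n x)" for x
  proof (cases "x = 0")
    case False
    have "convergent (\<lambda>n. norm x * h n (x /\<^sub>R norm x))"
      using False by (intro convergent_mult convergent_const ball) simp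
    moreover have "norm x * h n (x /\<^sub>R norm x) = h n x" for n
      using False by (simp add: blinfun.scaleR_right)
    ultimately show ?thesis by simp
  qed (simp add: blinfun.zero_right convergent_const)
  then show ?thesis using that hf by blast
qed

text \<open>If \<open>h\<close> were not Cauchy, differences of terms with indices tending to
  infinity would stay bounded below in norm, while pointwise convergence makes them weak* null.
  Completeness of the dual does the rest.\<close>

lemma convergent_if_pointwise_convergent:
  fixes h :: "nat \<Rightarrow> 'a::real_normed_vector \<Rightarrow>\<^sub>L real"
  assumes h: "\<And>x. convergent (\<lambda>n. h n x)" and no: "\<not> has_seminormalized_null_sequence TYPE('a)"
  shows "convergent h"
proof -
  have "Cauchy h"
  proof (rule ccontr)
    assume "\<not> Cauchy h"
    then obtain e where e: "e > 0" "\<And>N. \<exists>m\<ge>N. \<exists>n\<ge>N. e \<le> dist (h m) (h n)"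
      unfolding Cauchy_def by (meson not_less)
    then obtain p q where pq: "\<And>N. p N \<ge> N" "\<And>N. q N \<ge> N" "\<And>N. e \<le> dist (h (p N)) (h (q N))"
      by metis
    have lim: "filterlim p at_top sequentially" "filterlim q at_top sequentially"
      using pq(1,2) by (auto intro: filterlim_at_top_mono[OF filterlim_ident])
    have "weak_star_null (\<lambda>N. h (p N) - h (q N))"
      unfolding weak_star_null_def
    proof
      fix x
      obtain l where l: "(\<lambda>n. h n x) \<longlonglongrightarrow> l" using h[of x] by (auto simp: convergent_def)
      have "(\<lambda>N. h (p N) x - h (q N) x) \<longlonglongrightarrow> l - l"
        by (intro tendsto_diff filterlim_compose[OF l] lim)
      then show "(\<lambda>N. (h (p N) - h (q N)) x) \<longlonglongrightarrow> 0" by (simp add: blinfun.diff_left)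
    qed
    then show False
      using no e(1) pq(3) unfolding has_seminormalized_null_sequence_def dist_norm by blast
  qed
  then show ?thesis by (rule Cauchy_convergent)
qed

theorem seminormalized_null_sequence:
  assumes inf: "\<nexists>B :: 'a::real_normed_vector set. finite B \<and> span B = UNIV"
  shows "has_seminormalized_null_sequence TYPE('a)"
proof (rule ccontr)
  assume no: "\<not> ?thesis"
  obtain f :: "nat \<Rightarrow> 'a \<Rightarrow>\<^sub>L real" and N :: "nat \<Rightarrow> 'a set"
  where f: "\<And>n. norm (f n) = 1" and N: "\<And>m. N m \<subseteq> cball 0 1"
    and van: "\<And>m n u. m \<le> n \<Longrightarrow> u \<in> N m \<Longrightarrow> f n u = 0"
    and norming: "\<And>m e r. e \<in> span (f ` {..<m}) \<Longrightarrow> r \<ge> 0 \<Longrightarrow>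
      (\<And>u. u \<in> N m \<Longrightarrow> \<bar>blinfun_apply e u\<bar> \<le> r) \<Longrightarrow> norm e \<le> 2 * r"
    using exists_Mazur_sequence[OF inf] by blast
  have "\<not> weak_star_null f"
    using no f unfolding has_seminormalized_null_sequence_def by (metis order_refl zero_less_one)
  then obtain w where "\<not> (\<lambda>n. f n w) \<longlonglongrightarrow> 0" unfolding weak_star_null_def by blast
  then obtain e where e: "e > 0" "\<exists>\<^sub>\<infinity>n. e \<le> \<bar>f n w\<bar>"
    unfolding lim_sequentially dist_real_def INFM_nat_le by (metis not_less diff_zero)
  \<comment> \<open>One of \<open>w\<close> and \<open>- w\<close> gives large values without the
    absolute value, a condition that convex combinations preserve.\<close>
  have "\<exists>\<^sub>\<infinity>n. e \<le> f n w \<or> e \<le> f n (- w)"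
    using e(2) by (rule frequently_elim1) (auto simp: blinfun.minus_right)
  then obtain x where x: "\<exists>\<^sub>\<infinity>n. e \<le> f n x" by (auto simp: frequently_disj_iff)
  obtain r :: "nat \<Rightarrow> nat" where r: "strict_mono r" "\<And>n. e \<le> f (r n) x"
    using INFM_subsequence[OF x] by blast
  obtain h where h: "convex_blocks h (\<lambda>n. f (r n))" "\<And>x. convergent (\<lambda>n. h n x)"
    using exists_pointwise_convergent_convex_blocks[of "\<lambda>n. f (r n)"] f no by auto
  obtain G where G: "h \<longlonglongrightarrow> G"
    using convergent_if_pointwise_convergent[OF h(2) no] by (auto simp: convergent_def)
  have Gx: "(\<lambda>n. h n x) \<longlonglongrightarrow> G x" for x by (intro tendsto_intros G)
  have "e \<le> h n x" for n using convex_blocks_apply[OF h(1), of "{e..}" n x] r(2) by auto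
  then have "e \<le> G x" using Gx[of x] by (intro LIMSEQ_le_const) auto
  \<comment> \<open>Some \<open>h n\<close> is within \<open>d\<close> of \<open>G\<close> and lies
    in the span of finitely many terms of \<open>f\<close>, so one set \<open>N m\<close> controls
    its norm. Since \<open>G\<close> vanishes there, \<open>h n\<close> is at most \<open>d\<close>
    on \<open>N m\<close>, and \<open>norm G \<le> 2 * d + d\<close>.\<close>
  have small: "norm G \<le> 3 * d" if d: "d > 0" for d
  proof -
    obtain n where n: "norm (h n - G) < d" using G d by (metis LIMSEQ_D order_refl)
    have "h n \<in> span (range f)"
    proof -
      have "convex hull ((\<lambda>n. f (r n)) ` {n..}) \<subseteq> span (range f)"
        by (intro hull_minimal) (auto intro: span_base subspace_imp_convex)
      then show ?thesis using convex_blocksD[OF h(1), of n] by blast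
    qed
    then obtain T c where T: "finite T" "T \<subseteq> range f" and hT: "h n = (\<Sum>a\<in>T. c a *\<^sub>R a)"
      unfolding span_explicit by blast
    have "h n \<in> span T" unfolding hT by (intro span_sum span_scale span_base)
    obtain I where I: "finite I" "T = f ` I" using T by (meson finite_subset_image)
    then obtain m where m: "I \<subseteq> {..<m}" using finite_nat_iff_bounded by blast
    have hm: "h n \<in> span (f ` {..<m})" using \<open>h n \<in> span T\<close> I(2) m span_mono[of T "f ` {..<m}"] by blast
    have "\<bar>h n u\<bar> \<le> d" if u: "u \<in> N m" for u
    proof -
      \<comment> \<open>\<open>h k\<close> combines terms \<open>f (r i)\<close> with
        \<open>r i \<ge> i \<ge> k \<ge> m\<close>, all of which vanish on
        \<open>N m\<close>.\<close>
      have "h k u = 0" if "k \<ge> m" for k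
      proof -
        have "f (r i) u = 0" if "i \<ge> k" for i
          using van[OF _ u, of "r i"] seq_suble[OF r(1), of i] that \<open>k \<ge> m\<close> by linarith
        then have "h k u \<in> {0}" by (intro convex_blocks_apply[OF h(1)]) auto
        then show ?thesis by simp
      qed
      then have "(\<lambda>k. h k u) \<longlonglongrightarrow> 0" by (rule tendsto_eventually[OF eventually_sequentiallyI])
      then have "G u = 0" using Gx[of u] LIMSEQ_unique by blast
      moreover have "\<bar>(h n - G) u\<bar> \<le> norm (h n - G)" using u N[of m] by (intro abs_blinfun_le) auto
      ultimately show ?thesis using n by (simp add: blinfun.diff_left)
    qed
    then have "norm (h n) \<le> 2 * d" using norming[OF hm] d by simp
    then show ?thesis using n norm_triangle_ineq2[of G "h n"] by (simp add: norm_minus_commute)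
  qed
  have "G = 0"
  proof (rule ccontr)
    assume "G \<noteq> 0"
    then show False using small[of "norm G / 6"] by simp
  qed
  with \<open>e \<le> G x\<close> show False using e(1) by simp
qed

text \<open>Dividing by norms that are at least \<open>c\<close> enlarges values by a factor of at
  most \<open>1 / c\<close>, so weak* convergence to 0 survives normalisation.\<close>

corollary Josefson_Nissenzweig:
  assumes inf: "\<nexists>B :: 'a::real_normed_vector set. finite B \<and> span B = UNIV"
  obtains \<phi> :: "nat \<Rightarrow> 'a::real_normed_vector \<Rightarrow>\<^sub>L real" where "weak_star_null \<phi>" "\<And>n. norm (\<phi> n) = 1"
proof -
  obtain \<psi> :: "nat \<Rightarrow> 'a \<Rightarrow>\<^sub>L real" and c where \<psi>: "c > 0" "weak_star_null \<psi>" "\<And>n. c \<le> norm (\<psi> n)"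
    using seminormalized_null_sequence[OF inf] unfolding has_seminormalized_null_sequence_def by blast
  have pos: "norm (\<psi> n) > 0" for n using \<psi>(1) \<psi>(3)[of n] by linarith
  have "weak_star_null (\<lambda>n. \<psi> n /\<^sub>R norm (\<psi> n))"
    unfolding weak_star_null_def
  proof
    fix x
    have lim: "(\<lambda>n. \<bar>\<psi> n x\<bar> / c) \<longlonglongrightarrow> 0 / c"
      using \<psi>(1,2) unfolding weak_star_null_def by (intro tendsto_divide tendsto_rabs_zero tendsto_const) auto
    have le: "\<bar>(\<psi> n /\<^sub>R norm (\<psi> n)) x\<bar> \<le> \<bar>\<psi> n x\<bar> / c" for n
      using \<psi>(1) \<psi>(3)[of n] pos[of n]
      by (simp add: blinfun.scaleR_left abs_mult field_simps mult_right_mono)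
    show "(\<lambda>n. (\<psi> n /\<^sub>R norm (\<psi> n)) x) \<longlonglongrightarrow> 0"
    proof (rule Lim_null_comparison)
      show "\<forall>\<^sub>F n in sequentially. norm ((\<psi> n /\<^sub>R norm (\<psi> n)) x) \<le> \<bar>\<psi> n x\<bar> / c"
        unfolding real_norm_def using le by (intro always_eventually allI)
      show "(\<lambda>n. \<bar>\<psi> n x\<bar> / c) \<longlonglongrightarrow> 0" using lim by (simp only: div_0)
    qed
  qed
  moreover have "norm (\<psi> n /\<^sub>R norm (\<psi> n)) = 1" for n using pos[of n] by simp
  ultimately show ?thesis by (rule that)
qed

section \<open>Limited and Frechet differentiability\<close>

lemma limited_set_iff_uniform_limit:
  "limited_set A \<longleftrightarrow> bounded A \<and>
    (\<forall>\<phi>. weak_star_null \<phi> \<longrightarrow> uniform_limit A (\<lambda>n. blinfun_apply (\<phi> n)) (\<lambda>_. 0) sequentially)"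
  unfolding limited_set_def tendsto_SUP_ennreal_iff_uniform_limit[symmetric] by simp

section \<open>Finite dimension: from limited to Frechet differentiability\<close>

lemma limited_set_finite:
  assumes "finite A"
  shows "limited_set A"
  unfolding limited_set_iff_uniform_limit
proof (intro conjI allI impI)
  show "bounded A" using assms by (rule finite_imp_bounded)
  fix \<phi> :: "nat \<Rightarrow> 'a \<Rightarrow>\<^sub>L real" assume \<phi>: "weak_star_null \<phi>"
  show "uniform_limit A (\<lambda>n. blinfun_apply (\<phi> n)) (\<lambda>_. 0) sequentially"
    unfolding uniform_limit_iff
  proof (intro allI impI)
    fix e :: real assume "e > 0"
    then have "\<forall>x\<in>A. \<forall>\<^sub>F n in sequentially. dist (\<phi> n x) 0 < e"
      using \<phi> unfolding weak_star_null_def by (metis tendstoD)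
    with assms show "\<forall>\<^sub>F n in sequentially. \<forall>x\<in>A. dist (\<phi> n x) 0 < e"
      by (rule eventually_ball_finite)
  qed
qed

lemma limited_differentiable_iff_uniform_limit:
  "limited_differentiable f x \<longleftrightarrow> (\<exists>D :: 'a::real_normed_vector \<Rightarrow>\<^sub>L real. \<forall>A. A \<noteq> {} \<longrightarrow> limited_set A \<longrightarrow>
    uniform_limit A (\<lambda>t u. (f (x + t *\<^sub>R u) - f x) / t) (blinfun_apply D) (at 0))"
  unfolding limited_differentiable_def beta_differentiable_def tendsto_SUP_ennreal_iff_uniform_limit
  by auto

lemma frechet_differentiable_iff_uniform_limit:
  "frechet_differentiable f x \<longleftrightarrow> (\<exists>D :: 'a::real_normed_vector \<Rightarrow>\<^sub>L real. \<forall>A. A \<noteq> {} \<longrightarrow> bounded A \<longrightarrow>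
    uniform_limit A (\<lambda>t u. (f (x + t *\<^sub>R u) - f x) / t) (blinfun_apply D) (at 0))"
  unfolding frechet_differentiable_def beta_differentiable_def tendsto_SUP_ennreal_iff_uniform_limit
  by auto

lemma frechet_imp_limited_differentiable: "frechet_differentiable f x \<Longrightarrow> limited_differentiable f x"
  unfolding limited_differentiable_iff_uniform_limit frechet_differentiable_iff_uniform_limit
    limited_set_def by blast

text \<open>A bounded set is covered by small balls around a finite, hence limited, set of centres.
  The difference quotients are \<open>L\<close>-Lipschitz in the direction, uniformly in
  \<open>t\<close>, so uniform convergence carries over from the centres.\<close>

lemma limited_imp_frechet_differentiable:
  fixes f :: "'a::real_normed_vector \<Rightarrow> real"
  assumes B: "finite B" "span B = (UNIV :: 'a set)"
    and lip: "L-lipschitz_on UNIV f" and lim: "limited_differentiable f x"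
  shows "frechet_differentiable f x"
proof -
  let ?g = "\<lambda>t u. (f (x + t *\<^sub>R u) - f x) / t"
  obtain D :: "'a \<Rightarrow>\<^sub>L real" where D: "\<And>A. A \<noteq> {} \<Longrightarrow> limited_set A \<Longrightarrow> uniform_limit A ?g (blinfun_apply D) (at 0)"
    using lim unfolding limited_differentiable_iff_uniform_limit by blast
  have L: "L \<ge> 0" using lip by (rule lipschitz_on_nonneg)
  have "uniform_limit A ?g (blinfun_apply D) (at 0)" if A: "A \<noteq> {}" "bounded A" for A
    unfolding uniform_limit_iff
  proof (intro allI impI)
    fix e :: real assume e: "e > 0"
    \<comment> \<open>\<open>L + norm D\<close> bounds the total change of quotient and derivative
      per unit of direction; adding 1 makes \<open>K\<close> positive. Moving by less than
      \<open>r\<close> then costs at most \<open>e / 2\<close>.\<close>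
    define K where "K = L + norm D + 1"
    have K: "K > 0" using L by (simp add: K_def add_nonneg_pos)
    define r where "r = e / (2 * K)"
    have r: "r > 0" "K * r = e / 2" using e K by (auto simp: r_def)
    obtain R where R: "\<And>u. u \<in> A \<Longrightarrow> norm u \<le> R" using A(2) by (auto simp: bounded_iff)
    have "compact (cball (0::'a) R)" using compact_span_Int_cball[OF B(1), of R] B(2) by simp
    moreover have "cball (0::'a) R \<subseteq> (\<Union>v\<in>cball 0 R. ball v r)" using r(1) by force
    ultimately obtain F where F: "F \<subseteq> cball (0::'a) R" "finite F" "cball (0::'a) R \<subseteq> (\<Union>v\<in>F. ball v r)"
      using compactE_image[of "cball (0::'a) R" "cball 0 R" "\<lambda>v. ball v r"] open_ball by metis
    have "F \<noteq> {}" using A(1) R F(3) by fastforce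
    then have "uniform_limit F ?g (blinfun_apply D) (at 0)" by (rule D) (rule limited_set_finite[OF F(2)])
    then have "\<forall>\<^sub>F t in at 0. \<forall>v\<in>F. dist (?g t v) (D v) < e / 2"
      by (rule uniform_limitD) (use e in simp)
    moreover have "\<forall>\<^sub>F t in at (0::real). t \<noteq> 0" by (simp add: eventually_at_filter)
    ultimately show "\<forall>\<^sub>F t in at 0. \<forall>u\<in>A. dist (?g t u) (D u) < e"
    proof eventually_elim
      case (elim t)
      show ?case
      proof
        fix u assume "u \<in> A"
        then have "u \<in> cball 0 R" using R by simp
        then obtain v where v: "v \<in> F" "dist v u < r" using F(3) by auto
        have "\<bar>f (x + t *\<^sub>R u) - f (x + t *\<^sub>R v)\<bar> \<le> L * dist (x + t *\<^sub>R u) (x + t *\<^sub>R v)"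
          using lipschitz_onD[OF lip, of "x + t *\<^sub>R u" "x + t *\<^sub>R v"] by (simp add: dist_real_def)
        also have "dist (x + t *\<^sub>R u) (x + t *\<^sub>R v) = \<bar>t\<bar> * norm (u - v)"
          by (simp add: dist_norm flip: scaleR_diff_right)
        finally have "\<bar>f (x + t *\<^sub>R u) - f (x + t *\<^sub>R v)\<bar> / \<bar>t\<bar> \<le> L * norm (u - v)"
          using elim(2) by (simp add: field_simps)
        moreover have "?g t u - ?g t v = (f (x + t *\<^sub>R u) - f (x + t *\<^sub>R v)) / t"
          by (simp add: diff_divide_distrib)
        ultimately have "\<bar>?g t u - ?g t v\<bar> \<le> L * norm (u - v)" by simp
        moreover have "\<bar>D u - D v\<bar> \<le> norm D * norm (u - v)"
          using norm_blinfun[of D "u - v"] by (simp add: blinfun.diff_right)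
        moreover have "\<bar>?g t v - D v\<bar> < e / 2" using elim(1) v(1) by (simp add: dist_real_def)
        moreover have "L * norm (u - v) + norm D * norm (u - v) \<le> e / 2"
        proof -
          have "L * norm (u - v) + norm D * norm (u - v) \<le> K * norm (u - v)"
            by (simp add: K_def algebra_simps)
          also have "\<dots> \<le> K * r" using v(2) K by (simp add: dist_norm norm_minus_commute)
          finally show ?thesis using r(2) by simp
        qed
        ultimately show "dist (?g t u) (D u) < e" unfolding dist_real_def by linarith
      qed
    qed
  qed
  then show ?thesis unfolding frechet_differentiable_iff_uniform_limit by blast
qed

section \<open>Infinite dimension: the counterexample built from a normalised weak* null
  sequence\<close>

lemma exists_limited_not_frechet_differentiable:
  fixes \<phi> :: "nat \<Rightarrow> 'a::real_normed_vector \<Rightarrow>\<^sub>L real"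
  assumes null: "weak_star_null \<phi>" and norm1: "\<And>n. norm (\<phi> n) = 1"
  obtains f :: "'a \<Rightarrow> real"
  where "1-lipschitz_on UNIV f" "limited_differentiable f 0" "\<not> frechet_differentiable f 0"
proof -
  define c where "c = (\<lambda>n. 1 / real (Suc n))"
  have c: "c n > 0" for n by (simp add: c_def)
  \<comment> \<open>The positive thresholds silence any finite set of terms near 0, and their
    convergence to 0 leaves a term of proportional size at every small scale.\<close>
  define f where "f = (\<lambda>x. SUP n. max 0 (\<bar>\<phi> n x\<bar> - c n))"
  have abs_le: "\<bar>\<phi> n x\<bar> \<le> norm x" for n x using norm_blinfun[of "\<phi> n" x] norm1 by simp
  have bdd: "bdd_above (range (\<lambda>n. max 0 (\<bar>\<phi> n x\<bar> - c n)))" for x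
  proof (rule bdd_aboveI2)
    show "max 0 (\<bar>\<phi> n x\<bar> - c n) \<le> norm x" for n using abs_le[of n x] c[of n] by simp
  qed
  have lower: "max 0 (\<bar>\<phi> n x\<bar> - c n) \<le> f x" for n x
    unfolding f_def by (rule cSUP_upper[OF UNIV_I bdd])
  have upper: "f x \<le> b" if "0 \<le> b" "\<And>n. \<bar>\<phi> n x\<bar> - c n \<le> b" for x b
    unfolding f_def using that by (intro cSUP_least) auto
  have nonneg: "0 \<le> f x" for x using lower[of 0 x] by simp
  have ge: "\<bar>\<phi> n x\<bar> - c n \<le> f x" for n x using lower[of n x] by simp
  have f0: "f 0 = 0"
  proof (rule antisym)
    show "f 0 \<le> 0" by (rule upper) (simp_all add: blinfun.zero_right less_imp_le[OF c])
  qed (rule nonneg)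
  have "f x \<le> f y + norm (x - y)" for x y
  proof (rule upper)
    fix n
    have "\<bar>\<phi> n x\<bar> \<le> \<bar>\<phi> n y\<bar> + \<bar>\<phi> n (x - y)\<bar>" by (simp add: blinfun.diff_right)
    then show "\<bar>\<phi> n x\<bar> - c n \<le> f y + norm (x - y)" using ge[of n y] abs_le[of n "x - y"] by linarith
  qed (simp add: nonneg)
  then have "dist (f x) (f y) \<le> 1 * dist x y" for x y
    unfolding dist_norm real_norm_def by (smt (verit, best) norm_minus_commute)
  then have lip: "1-lipschitz_on UNIV f" by (intro lipschitz_onI) auto
  have unif: "uniform_limit A (\<lambda>t u. (f (0 + t *\<^sub>R u) - f 0) / t) (blinfun_apply 0) (at 0)"
    if A: "limited_set A" for A
    unfolding uniform_limit_iff
  proof (intro allI impI)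
    fix e :: real assume e: "e > 0"
    obtain M where M: "M > 0" "\<And>u. u \<in> A \<Longrightarrow> norm u \<le> M"
      using A unfolding limited_set_def bounded_pos by blast
    have "uniform_limit A (\<lambda>n. blinfun_apply (\<phi> n)) (\<lambda>_. 0) sequentially"
      using A null unfolding limited_set_iff_uniform_limit by blast
    then have "\<forall>\<^sub>F n in sequentially. \<forall>u\<in>A. dist (\<phi> n u) 0 < e / 2"
      by (rule uniform_limitD) (use e in simp)
    then obtain N where N: "\<And>n u. n \<ge> N \<Longrightarrow> u \<in> A \<Longrightarrow> \<bar>\<phi> n u\<bar> < e / 2"
      by (auto simp: eventually_sequentially)
    have "dist ((f (0 + t *\<^sub>R u) - f 0) / t) (blinfun_apply 0 u) < e"
      \<comment> \<open>This range of \<open>t\<close> makes all terms with index below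
        \<open>N\<close> vanish, as \<open>\<bar>t\<bar> * M < c N \<le> c n\<close> there; later
        terms are small by uniform convergence on \<open>A\<close>.\<close>
      if t: "t \<noteq> 0" "\<bar>t\<bar> < c N / M" and u: "u \<in> A" for t u
    proof -
      have "f (t *\<^sub>R u) \<le> \<bar>t\<bar> * (e / 2)"
      proof (rule upper)
        show "\<bar>\<phi> n (t *\<^sub>R u)\<bar> - c n \<le> \<bar>t\<bar> * (e / 2)" for n
        proof (cases "n \<ge> N")
          case True
          have "\<bar>t\<bar> * \<bar>\<phi> n u\<bar> \<le> \<bar>t\<bar> * (e / 2)"
            using N[OF True u] by (intro mult_left_mono) auto
          then show ?thesis using c[of n] by (simp add: blinfun.scaleR_right abs_mult)
        next
          case False
          have "\<bar>\<phi> n (t *\<^sub>R u)\<bar> \<le> norm (t *\<^sub>R u)" by (rule abs_le)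
          also have "\<dots> \<le> \<bar>t\<bar> * M" using M(2)[OF u] by (simp add: mult_left_mono)
          also have "\<dots> \<le> c N" using t(2) M(1) by (simp add: field_simps)
          also have "\<dots> \<le> c n" using False by (simp add: c_def frac_le)
          finally have "\<bar>\<phi> n (t *\<^sub>R u)\<bar> - c n \<le> 0" by simp
          also have "0 \<le> \<bar>t\<bar> * (e / 2)" using e by simp
          finally show ?thesis .
        qed
      qed (use e in simp)
      also have "\<dots> < e * \<bar>t\<bar>" using e t(1) by simp
      finally have "f (t *\<^sub>R u) / \<bar>t\<bar> < e" using t(1) by (simp add: pos_divide_less_eq)
      then show ?thesis using nonneg[of "t *\<^sub>R u"] by (simp add: dist_real_def f0)
    qed
    moreover have "c N / M > 0" using c M by simp
    ultimately show "\<forall>\<^sub>F t in at 0. \<forall>u\<in>A. dist ((f (0 + t *\<^sub>R u) - f 0) / t) (blinfun_apply 0 u) < e"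
      unfolding eventually_at by (intro exI[of _ "c N / M"]) (simp add: dist_real_def)
  qed
  then have limd: "limited_differentiable f 0"
    unfolding limited_differentiable_iff_uniform_limit by blast
  have "\<not> frechet_differentiable f 0"
  proof
    assume "frechet_differentiable f 0"
    then obtain D :: "'a \<Rightarrow>\<^sub>L real" where D: "\<And>A. A \<noteq> {} \<Longrightarrow> bounded A \<Longrightarrow>
        uniform_limit A (\<lambda>t u. (f (0 + t *\<^sub>R u) - f 0) / t) (blinfun_apply D) (at 0)"
      unfolding frechet_differentiable_iff_uniform_limit by blast
    \<comment> \<open>Singletons are both limited and bounded, so a Frechet derivative must agree
      with the limited derivative, which is 0.\<close>
    have D0: "D u = 0" for u
    proof -
      have "((\<lambda>t. (f (0 + t *\<^sub>R u) - f 0) / t) \<longlongrightarrow> D u) (at 0)"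
        by (rule tendsto_uniform_limitI[OF D[of "{u}"]]) auto
      moreover have "((\<lambda>t. (f (0 + t *\<^sub>R u) - f 0) / t) \<longlongrightarrow> blinfun_apply 0 u) (at 0)"
        by (rule tendsto_uniform_limitI[OF unif[of "{u}"]]) (auto intro: limited_set_finite)
      ultimately have "D u = blinfun_apply 0 u" by (rule tendsto_unique[OF trivial_limit_at])
      then show ?thesis by simp
    qed
    have "uniform_limit (cball 0 1) (\<lambda>t u. (f (0 + t *\<^sub>R u) - f 0) / t) (blinfun_apply D) (at 0)"
      by (rule D) auto
    then have "\<forall>\<^sub>F t in at 0. \<forall>u\<in>cball 0 1. dist ((f (0 + t *\<^sub>R u) - f 0) / t) (D u) < 1/4"
      by (rule uniform_limitD) simp
    then obtain d where d: "d > 0" "\<And>t u. t \<noteq> 0 \<Longrightarrow> \<bar>t\<bar> < d \<Longrightarrow> norm u \<le> 1 \<Longrightarrow> \<bar>f (t *\<^sub>R u) / t\<bar> < 1/4"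
      unfolding eventually_at by (auto simp: dist_real_def f0 D0)
    obtain n where n: "c n < d / 2" using d(1) nat_approx_posE[of "d / 2"] unfolding c_def by auto
    obtain u where u: "norm u \<le> 1" "3/4 < \<bar>\<phi> n u\<bar>"
      using exists_point_near_norm[of "3/4" "\<phi> n"] norm1 by auto
    \<comment> \<open>At this scale the threshold \<open>c n\<close> is \<open>t / 2\<close>, so the
      \<open>n\<close>-th term at \<open>t *\<^sub>R u\<close> is at least
      \<open>3/4 * t - t / 2\<close>, a quarter of \<open>t\<close>.\<close>
    define t where "t = 2 * c n"
    have t: "t > 0" "t < d" using n c[of n] by (auto simp: t_def)
    have "t * (3/4) \<le> t * \<bar>\<phi> n u\<bar>" using u(2) t(1) by (intro mult_left_mono) auto
    also have "\<dots> = \<bar>\<phi> n (t *\<^sub>R u)\<bar>" using t(1) by (simp add: blinfun.scaleR_right abs_mult)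
    also have "\<dots> \<le> f (t *\<^sub>R u) + t / 2" using ge[of n "t *\<^sub>R u"] by (simp add: t_def)
    finally have "1/4 \<le> f (t *\<^sub>R u) / t" using t(1) by (simp add: field_simps)
    then show False using d(2)[of t u] t u(1) by simp
  qed
  then show ?thesis using lip limd that by blast
qed

theorem corollary6p6:
  shows "(\<exists>B :: 'a::banach set. finite B \<and> span B = UNIV) \<longleftrightarrow>
    (\<forall>f :: 'a \<Rightarrow> real. (\<exists>L. L-lipschitz_on UNIV f) \<longrightarrow>
       (\<forall>x. limited_differentiable f x \<longleftrightarrow> frechet_differentiable f x))"
proof
  assume "\<exists>B :: 'a set. finite B \<and> span B = UNIV"
  then show "\<forall>f :: 'a \<Rightarrow> real. (\<exists>L. L-lipschitz_on UNIV f) \<longrightarrow>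
       (\<forall>x. limited_differentiable f x \<longleftrightarrow> frechet_differentiable f x)"
    using limited_imp_frechet_differentiable frechet_imp_limited_differentiable by metis
next
  assume coincide: "\<forall>f :: 'a \<Rightarrow> real. (\<exists>L. L-lipschitz_on UNIV f) \<longrightarrow>
       (\<forall>x. limited_differentiable f x \<longleftrightarrow> frechet_differentiable f x)"
  show "\<exists>B :: 'a set. finite B \<and> span B = UNIV"
  proof (rule ccontr)
    assume "\<nexists>B :: 'a set. finite B \<and> span B = UNIV"
    then obtain \<phi> :: "nat \<Rightarrow> 'a \<Rightarrow>\<^sub>L real" where "weak_star_null \<phi>" "\<And>n. norm (\<phi> n) = 1"
      using Josefson_Nissenzweig by blast
    then obtain f :: "'a \<Rightarrow> real"
      where "1-lipschitz_on UNIV f" "limited_differentiable f 0" "\<not> frechet_differentiable f 0"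
      by (rule exists_limited_not_frechet_differentiable)
    then show False using coincide by blast
  qed
qed

end
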